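(* Let $R$ be a reduced commutative noetherian ring with normalization $\overline{R}$. The following are equivalent: (i) $R$ satisfies Serre's condition $(S_2)$; (ii) no prime ideal of height at least two belongs to $\operatorname{Ass}_R(\overline{R}/R)$, i.e. $\operatorname{Ass}(\overline{R}/R)^{\geq 2}=\emptyset$; (iii) no prime ideal of height at least two is reflexive, i.e. $\{\mathfrak{p}\in\operatorname{Spec}(R):\mathfrak{p}^{\ast\ast}=\mathfrak{p}\}^{\geq 2}=\emptyset$.
   Context: The total quotient ring $Q(R)$ is the localization of $R$ at the set of all non-zerodivisors, and the normalization $\overline{R}$ is the integral closure of $R$ in $Q(R)$. For $X\subseteq\operatorname{Spec}(R)$, $X^{\geq i}:=\{\mathfrak{p}\in X:\operatorname{ht}(\mathfrak{p})\geq i\}$. $\operatorname{Ass}(M)$ is the set of associated primes of the $R$-module $M$. $(-)^\ast:=\operatorname{Hom}_R(-,R)$; $\mathfrak{p}^{\ast\ast}=\mathfrak{p}$ means that $\mathfrak{p}$ is a reflexive $R$-module, i.e. the natural map $\mathfrak{p}\to\mathfrak{p}^{\ast\ast}$ is an isomorphism. $(S_n)$ means $\operatorname{depth}(R_{\mathfrak{p}})\geq\min\{n,\operatorname{ht}(\mathfrak{p})\}$ for all $\mathfrak{p}\in\operatorname{Spec}(R)$. *)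

theory Defs
  imports "HOL-Algebra.Algebra" "HOL-Library.Extended_Nat"
begin

section \<open>Rings, prime spectrum and height\<close>

definition reduced_ring :: "('a, 'b) ring_scheme \<Rightarrow> bool" where
  "reduced_ring R \<longleftrightarrow>
     (\<forall>x \<in> carrier R. \<forall>n::nat. x [^]\<^bsub>R\<^esub> n = \<zero>\<^bsub>R\<^esub> \<longrightarrow> x = \<zero>\<^bsub>R\<^esub>)"

definition nonzerodivisors :: "('a, 'b) ring_scheme \<Rightarrow> 'a set" where
  "nonzerodivisors R =
     {a \<in> carrier R. \<forall>b \<in> carrier R. a \<otimes>\<^bsub>R\<^esub> b = \<zero>\<^bsub>R\<^esub> \<longrightarrow> b = \<zero>\<^bsub>R\<^esub>}"

definition Spec :: "('a, 'b) ring_scheme \<Rightarrow> 'a set set" where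
  "Spec R = {P. primeideal P R}"

text \<open>Supremum of the lengths \<open>n\<close> of chains \<open>c 0 \<subset> \<dots> \<subset> c n = P\<close> of prime ideals.\<close>

definition height :: "('a, 'b) ring_scheme \<Rightarrow> 'a set \<Rightarrow> enat" where
  "height R P =
     (SUP n \<in> {n. \<exists>c. (\<forall>i\<le>n. c i \<in> Spec R) \<and> (\<forall>i<n. c i \<subset> c (Suc i)) \<and> c n = P}. enat n)"

definition height_ge :: "('a, 'b) ring_scheme \<Rightarrow> 'a set set \<Rightarrow> nat \<Rightarrow> 'a set set" where
  "height_ge R U i = {P \<in> U. height R P \<ge> enat i}"

section \<open>Localization\<close>

text \<open>The ring of fractions at a multiplicative set \<open>S\<close>, possibly containing zero divisors:
  \<open>(a, s)\<close> and \<open>(b, t)\<close> are identified iff \<open>u (t a - s b) = 0\<close> for some \<open>u \<in> S\<close>.\<close>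

definition frac_rel :: "('a, 'b) ring_scheme \<Rightarrow> 'a set \<Rightarrow> (('a \<times> 'a) \<times> ('a \<times> 'a)) set" where
  "frac_rel R S =
     {((a, s), (b, t)) | a s b t. a \<in> carrier R \<and> s \<in> S \<and> b \<in> carrier R \<and> t \<in> S \<and>
        (\<exists>u \<in> S. u \<otimes>\<^bsub>R\<^esub> (t \<otimes>\<^bsub>R\<^esub> a \<ominus>\<^bsub>R\<^esub> s \<otimes>\<^bsub>R\<^esub> b) = \<zero>\<^bsub>R\<^esub>)}"

definition frac :: "('a, 'b) ring_scheme \<Rightarrow> 'a set \<Rightarrow> 'a \<Rightarrow> 'a \<Rightarrow> ('a \<times> 'a) set" where
  "frac R S a s = frac_rel R S `` {(a, s)}"

definition localization :: "('a, 'b) ring_scheme \<Rightarrow> 'a set \<Rightarrow> ('a \<times> 'a) set ring" where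
  "localization R S =
     \<lparr>carrier = (carrier R \<times> S) // frac_rel R S,
      monoid.mult = (\<lambda>U V. \<Union>(a, s) \<in> U. \<Union>(b, t) \<in> V. frac R S (a \<otimes>\<^bsub>R\<^esub> b) (s \<otimes>\<^bsub>R\<^esub> t)),
      one = frac R S \<one>\<^bsub>R\<^esub> \<one>\<^bsub>R\<^esub>,
      ring.zero = frac R S \<zero>\<^bsub>R\<^esub> \<one>\<^bsub>R\<^esub>,
      add = (\<lambda>U V. \<Union>(a, s) \<in> U. \<Union>(b, t) \<in> V.
               frac R S (t \<otimes>\<^bsub>R\<^esub> a \<oplus>\<^bsub>R\<^esub> s \<otimes>\<^bsub>R\<^esub> b) (s \<otimes>\<^bsub>R\<^esub> t))\<rparr>"

definition localization_at :: "('a, 'b) ring_scheme \<Rightarrow> 'a set \<Rightarrow> ('a \<times> 'a) set ring" where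
  "localization_at R P = localization R (carrier R - P)"

definition total_quotient_ring :: "('a, 'b) ring_scheme \<Rightarrow> ('a \<times> 'a) set ring" where
  "total_quotient_ring R = localization R (nonzerodivisors R)"

definition to_tqr :: "('a, 'b) ring_scheme \<Rightarrow> 'a \<Rightarrow> ('a \<times> 'a) set" where
  "to_tqr R r = frac R (nonzerodivisors R) r \<one>\<^bsub>R\<^esub>"

section \<open>Depth and Serre's conditions\<close>

definition regular_sequence :: "('a, 'b) ring_scheme \<Rightarrow> 'a list \<Rightarrow> bool" where
  "regular_sequence A xs \<longleftrightarrow>
     set xs \<subseteq> carrier A \<and>
     (\<forall>i < length xs. let I = genideal A (set (take i xs))
        in I +>\<^bsub>A\<^esub> (xs ! i) \<in> nonzerodivisors (A Quot I)) \<and>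
     genideal A (set xs) \<noteq> carrier A"

text \<open>Meaningful only for local \<open>A\<close>, whose maximal ideal is unique.\<close>

definition local_depth :: "('a, 'b) ring_scheme \<Rightarrow> enat" where
  "local_depth A =
     (SUP xs \<in> {xs. regular_sequence A xs \<and> set xs \<subseteq> (THE M. maximalideal M A)}.
        enat (length xs))"

definition serre_condition :: "nat \<Rightarrow> ('a, 'b) ring_scheme \<Rightarrow> bool" where
  "serre_condition n R \<longleftrightarrow>
     (\<forall>P \<in> Spec R. local_depth (localization_at R P) \<ge> min (enat n) (height R P))"

section \<open>Modules\<close>

text \<open>The library's module records carry the multiplicative fields of a ring record;
  the module axioms do not mention them, and they are left \<^const>\<open>undefined\<close> where there
  is no natural choice.\<close>

definition module_hom ::
  "('a, 'r) ring_scheme \<Rightarrow> ('a, 'b, 'm) module_scheme \<Rightarrow> ('a, 'c, 'n) module_scheme \<Rightarrow> ('b \<Rightarrow> 'c) set"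
  where
  "module_hom R M N =
     {f \<in> carrier M \<rightarrow>\<^sub>E carrier N.
        (\<forall>x \<in> carrier M. \<forall>y \<in> carrier M. f (x \<oplus>\<^bsub>M\<^esub> y) = f x \<oplus>\<^bsub>N\<^esub> f y) \<and>
        (\<forall>r \<in> carrier R. \<forall>x \<in> carrier M. f (r \<odot>\<^bsub>M\<^esub> x) = r \<odot>\<^bsub>N\<^esub> f x)}"

definition module_iso ::
  "('a, 'r) ring_scheme \<Rightarrow> ('a, 'b, 'm) module_scheme \<Rightarrow> ('a, 'c, 'n) module_scheme \<Rightarrow> ('b \<Rightarrow> 'c) set"
  where
  "module_iso R M N = {f \<in> module_hom R M N. bij_betw f (carrier M) (carrier N)}"

definition hom_module ::
  "('a, 'r) ring_scheme \<Rightarrow> ('a, 'b, 'm) module_scheme \<Rightarrow> ('a, 'c, 'n) module_scheme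
    \<Rightarrow> ('a, 'b \<Rightarrow> 'c) module" where
  "hom_module R M N =
     \<lparr>carrier = module_hom R M N,
      monoid.mult = undefined,
      one = undefined,
      ring.zero = (\<lambda>x \<in> carrier M. \<zero>\<^bsub>N\<^esub>),
      add = (\<lambda>f g. \<lambda>x \<in> carrier M. f x \<oplus>\<^bsub>N\<^esub> g x),
      smult = (\<lambda>r f. \<lambda>x \<in> carrier M. r \<odot>\<^bsub>N\<^esub> f x)\<rparr>"

definition regular_module :: "('a, 'r) ring_scheme \<Rightarrow> ('a, 'a) module" where
  "regular_module R =
     \<lparr>carrier = carrier R, monoid.mult = monoid.mult R, one = \<one>\<^bsub>R\<^esub>, ring.zero = \<zero>\<^bsub>R\<^esub>,
      add = add R, smult = monoid.mult R\<rparr>"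

definition ideal_module :: "('a, 'r) ring_scheme \<Rightarrow> 'a set \<Rightarrow> ('a, 'a) module" where
  "ideal_module R I = (regular_module R)\<lparr>carrier := I\<rparr>"

definition dual_module ::
  "('a, 'r) ring_scheme \<Rightarrow> ('a, 'b, 'm) module_scheme \<Rightarrow> ('a, 'b \<Rightarrow> 'a) module" where
  "dual_module R M = hom_module R M (regular_module R)"

definition bidual_map ::
  "('a, 'r) ring_scheme \<Rightarrow> ('a, 'b, 'm) module_scheme \<Rightarrow> 'b \<Rightarrow> ('b \<Rightarrow> 'a) \<Rightarrow> 'a" where
  "bidual_map R M = (\<lambda>x \<in> carrier M. \<lambda>f \<in> carrier (dual_module R M). f x)"

definition reflexive_module ::
  "('a, 'r) ring_scheme \<Rightarrow> ('a, 'b, 'm) module_scheme \<Rightarrow> bool" where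
  "reflexive_module R M \<longleftrightarrow>
     bidual_map R M \<in> module_iso R M (dual_module R (dual_module R M))"

definition quotient_module :: "('a, 'b, 'm) module_scheme \<Rightarrow> 'b set \<Rightarrow> ('a, 'b set) module" where
  "quotient_module M N =
     \<lparr>carrier = a_rcosets\<^bsub>M\<^esub> N,
      monoid.mult = undefined,
      one = undefined,
      ring.zero = N,
      add = (\<lambda>U V. U <+>\<^bsub>M\<^esub> V),
      smult = (\<lambda>r U. \<Union>x \<in> U. N +>\<^bsub>M\<^esub> (r \<odot>\<^bsub>M\<^esub> x))\<rparr>"

definition Ass :: "('a, 'r) ring_scheme \<Rightarrow> ('a, 'b, 'm) module_scheme \<Rightarrow> 'a set set" where
  "Ass R M =
     {P \<in> Spec R. \<exists>x \<in> carrier M. P = {r \<in> carrier R. r \<odot>\<^bsub>M\<^esub> x = \<zero>\<^bsub>M\<^esub>}}"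

section \<open>Normalization\<close>

text \<open>Library polynomials are coefficient lists, leading coefficient first.\<close>

definition integral_over :: "('a, 'b) ring_scheme \<Rightarrow> 'a set \<Rightarrow> 'a \<Rightarrow> bool" where
  "integral_over A K x \<longleftrightarrow>
     (\<exists>p \<in> carrier (K[X]\<^bsub>A\<^esub>). p \<noteq> [] \<and> lead_coeff p = \<one>\<^bsub>A\<^esub> \<and> ring.eval A p x = \<zero>\<^bsub>A\<^esub>)"

definition integral_closure :: "('a, 'b) ring_scheme \<Rightarrow> 'a set \<Rightarrow> 'a set" where
  "integral_closure A K = {x \<in> carrier A. integral_over A K x}"

definition tqr_image :: "('a, 'b) ring_scheme \<Rightarrow> ('a \<times> 'a) set set" where
  "tqr_image R = to_tqr R ` carrier R"

text \<open>The normalization as an \<open>R\<close>-module (its ring structure is retained in the record).\<close>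

definition normalization :: "('a, 'b) ring_scheme \<Rightarrow> ('a, ('a \<times> 'a) set) module" where
  "normalization R = (let Q = total_quotient_ring R in
     \<lparr>carrier = integral_closure Q (tqr_image R), monoid.mult = monoid.mult Q,
      one = \<one>\<^bsub>Q\<^esub>, ring.zero = \<zero>\<^bsub>Q\<^esub>, add = add Q,
      smult = (\<lambda>r x. to_tqr R r \<otimes>\<^bsub>Q\<^esub> x)\<rparr>)"

end

theory Submission
  imports Defs
begin

text \<open>
  All three conditions are compared, prime by prime, with a fourth one. Call \<open>P\<close> a denominator
  ideal if \<open>P = {r. r q \<in> R}\<close> for some \<open>q = y / x\<close> in the total quotient ring \<open>Q\<close>, that is, if
  \<open>P\<close> (being prime) is associated to \<open>Q/R\<close>. For a prime \<open>P\<close> of height at least two it is shown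
  that
    \<^item> \<open>depth R\<^sub>P \<ge> 2\<close> iff \<open>P\<close> is not a denominator ideal;
    \<^item> \<open>P\<close> is reflexive iff \<open>P\<close> is a denominator ideal;
    \<^item> \<open>P\<close> is associated to the normalization modulo \<open>R\<close> iff \<open>P\<close> is a denominator ideal.

  As \<open>R\<close> is reduced and noetherian, every nonminimal prime contains a nonzerodivisor
  (\<open>nonminimal_prime_contains_nonzerodivisor\<close>). This makes the depth condition automatic at
  primes of height one, and lets the dual of \<open>P\<close> be read as the fractions \<open>q\<close> with \<open>q P \<subseteq> R\<close>.

  Depth (\<open>denominator_ideal_depth\<close>, \<open>depth_ge_2\<close>): for a nonzerodivisor \<open>x \<in> P\<close>, depth one means
  that \<open>P\<close> consists of zero divisors on the localization of \<open>R/xR\<close>, hence kills some nonzero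
  class \<open>y\<close> there (\<open>common_zerodivisor_witness\<close>); then \<open>P\<close> is the denominator ideal of \<open>y / x\<close>.

  Reflexivity (\<open>denominator_ideal_reflexive\<close>, \<open>reflexive_denominator_ideal\<close>): the bidual of \<open>P\<close> is
  the intersection of the denominator ideals of the fractions in its dual. Finitely many of these
  fractions suffice, and a prime that is a finite intersection of ideals is one of them.

  Normalization (\<open>Ass_normalization_denominator_ideal\<close>,
  \<open>denominator_ideal_Ass_normalization\<close>): only the integrality of \<open>q\<close> is at stake. If
  \<open>q P \<subseteq> P\<close>, then \<open>q\<close> is integral because \<open>R\<close> is noetherian; otherwise \<open>P\<close> becomes principal in
  \<open>R\<^sub>P\<close>, which is impossible in height two (\<open>locally_principal_prime_height\<close>).
\<close>

section \<open>Ideals in noetherian rings\<close>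

locale noetherian_cring = noetherian_ring R + cring R for R (structure)

text \<open>The ideal generated by \<open>w 0, \<dots>, w (n - 1)\<close>. Building it one generator at a time lets
  a property of linear combinations be proved by induction on their length.\<close>

primrec prefix_ideal :: "('a, 'b) ring_scheme \<Rightarrow> (nat \<Rightarrow> 'a) \<Rightarrow> nat \<Rightarrow> 'a set" where
  "prefix_ideal R w 0 = {\<zero>\<^bsub>R\<^esub>}"
| "prefix_ideal R w (Suc n) =
     {v \<oplus>\<^bsub>R\<^esub> r \<otimes>\<^bsub>R\<^esub> w n | v r. v \<in> prefix_ideal R w n \<and> r \<in> carrier R}"

lemma (in cring) idealI_cring:
  assumes "I \<subseteq> carrier R" "\<zero> \<in> I" "\<And>a b. \<lbrakk>a \<in> I; b \<in> I\<rbrakk> \<Longrightarrow> a \<oplus> b \<in> I"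
    and "\<And>a r. \<lbrakk>a \<in> I; r \<in> carrier R\<rbrakk> \<Longrightarrow> r \<otimes> a \<in> I"
  shows "ideal I R"
proof (rule idealI)
  show "subgroup I (add_monoid R)"
  proof (rule add.subgroupI)
    fix a assume a: "a \<in> I"
    then have "\<ominus> a = (\<ominus> \<one>) \<otimes> a" using assms(1) by (simp add: l_minus subsetD)
    then show "\<ominus> a \<in> I" using assms(4)[OF a] by simp
  qed (use assms in auto)
qed (use assms m_comm in \<open>auto simp: ring_axioms subset_iff\<close>)

lemma (in cring) ideal_carrier: "ideal I R \<Longrightarrow> a \<in> I \<Longrightarrow> a \<in> carrier R"
  by (rule ideal.Icarr)

lemma (in cring) ideal_zero: "ideal I R \<Longrightarrow> \<zero> \<in> I"
  by (simp add: additive_subgroup.zero_closed ideal.axioms(1))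

lemma (in cring) ideal_add: "\<lbrakk>ideal I R; a \<in> I; b \<in> I\<rbrakk> \<Longrightarrow> a \<oplus> b \<in> I"
  by (simp add: additive_subgroup.a_closed ideal.axioms(1))

lemma (in cring) prefix_ideal_ideal:
  assumes "range w \<subseteq> carrier R"
  shows "ideal (prefix_ideal R w n) R"
proof (induction n)
  case 0 then show ?case by (simp add: zeroideal)
next
  case (Suc n)
  have w: "w n \<in> carrier R" using assms by auto
  interpret I: ideal "prefix_ideal R w n" R by (rule Suc)
  show ?case
  proof (rule idealI_cring)
    show "prefix_ideal R w (Suc n) \<subseteq> carrier R" using w by auto
    show "\<zero> \<in> prefix_ideal R w (Suc n)"
      unfolding prefix_ideal.simps mem_Collect_eq
      by (rule exI[of _ "\<zero>"], rule exI[of _ "\<zero>"]) (use w ideal_zero[OF Suc] in auto)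
  next
    fix a b assume "a \<in> prefix_ideal R w (Suc n)" "b \<in> prefix_ideal R w (Suc n)"
    then obtain v r v' r' where *: "a = v \<oplus> r \<otimes> w n" "v \<in> prefix_ideal R w n" "r \<in> carrier R"
      "b = v' \<oplus> r' \<otimes> w n" "v' \<in> prefix_ideal R w n" "r' \<in> carrier R" by auto
    then have "v \<in> carrier R" "v' \<in> carrier R" by auto
    then have "a \<oplus> b = (v \<oplus> v') \<oplus> (r \<oplus> r') \<otimes> w n" using * w by algebra
    then show "a \<oplus> b \<in> prefix_ideal R w (Suc n)" using * by auto
  next
    fix a s assume "a \<in> prefix_ideal R w (Suc n)" and s: "s \<in> carrier R"
    then obtain v r where *: "a = v \<oplus> r \<otimes> w n" "v \<in> prefix_ideal R w n" "r \<in> carrier R" by auto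
    then have "v \<in> carrier R" by auto
    then have "s \<otimes> a = s \<otimes> v \<oplus> (s \<otimes> r) \<otimes> w n" using * w s by algebra
    then show "s \<otimes> a \<in> prefix_ideal R w (Suc n)" using * s by (auto intro: I.I_l_closed)
  qed
qed

lemma (in cring) prefix_ideal_step:
  assumes "range w \<subseteq> carrier R"
  shows "prefix_ideal R w n \<subseteq> prefix_ideal R w (Suc n)" "w n \<in> prefix_ideal R w (Suc n)"
proof -
  interpret I: ideal "prefix_ideal R w n" R by (rule prefix_ideal_ideal[OF assms])
  have w: "w n \<in> carrier R" using assms by auto
  show "prefix_ideal R w n \<subseteq> prefix_ideal R w (Suc n)"
  proof
    fix v assume v: "v \<in> prefix_ideal R w n"
    then have "v = v \<oplus> \<zero> \<otimes> w n" using w by simp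
    then show "v \<in> prefix_ideal R w (Suc n)" using v by auto
  qed
  show "w n \<in> prefix_ideal R w (Suc n)"
    unfolding prefix_ideal.simps mem_Collect_eq
    by (rule exI[of _ "\<zero>"], rule exI[of _ "\<one>"]) (use w ideal_zero[OF I.ideal_axioms] in auto)
qed

text \<open>The form in which the noetherian hypothesis is used most: the ideals of initial segments
  of a sequence cannot grow for ever, so some term is a linear combination of its predecessors.
  Applied to sequences built by repeated multiplication and division, it replaces the
  determinant trick and Nakayama's lemma.\<close>

lemma (in noetherian_cring) sequence_dependent:
  assumes w: "range w \<subseteq> carrier R"
  obtains n where "w n \<in> prefix_ideal R w n"
proof -
  have mono: "prefix_ideal R w m \<subseteq> prefix_ideal R w n" if "m \<le> n" for m n
    using lift_Suc_mono_le[of "prefix_ideal R w", OF prefix_ideal_step(1)[OF w] that] .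
  have "\<Union>(range (prefix_ideal R w)) \<in> range (prefix_ideal R w)"
  proof (rule ideal_chain_is_trivial)
    show "subset.chain {I. ideal I R} (range (prefix_ideal R w))"
    proof -
      have "prefix_ideal R w m \<subseteq> prefix_ideal R w n \<or> prefix_ideal R w n \<subseteq> prefix_ideal R w m" for m n
        using mono by (cases "m \<le> n") simp_all
      then show ?thesis
        unfolding pred_on.chain_def using prefix_ideal_ideal[OF w] by blast
    qed
  qed auto
  then obtain n where n: "\<Union>(range (prefix_ideal R w)) = prefix_ideal R w n" by auto
  then have "prefix_ideal R w (Suc n) \<subseteq> prefix_ideal R w n" by (metis UN_upper UNIV_I)
  then show ?thesis using prefix_ideal_step(2)[OF w, of n] by (intro that) (rule subsetD)
qed

lemma (in noetherian_ring) exists_maximal_ideal_in_family: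
  assumes "I \<in> F" and F: "\<And>I. I \<in> F \<Longrightarrow> ideal I R"
  obtains M where "M \<in> F" "I \<subseteq> M" "\<And>J. \<lbrakk>J \<in> F; M \<subseteq> J\<rbrakk> \<Longrightarrow> J = M"
proof -
  define A where "A = {J \<in> F. I \<subseteq> J}"
  have upper: "\<exists>U\<in>A. \<forall>K\<in>C. K \<subseteq> U" if C: "subset.chain A C" for C
  proof (cases "C = {}")
    case True then show ?thesis using assms(1) by (auto simp: A_def)
  next
    case False
    have CA: "C \<subseteq> A" using C by (simp add: pred_on.chain_def)
    then have "C \<subseteq> {I. ideal I R}" using F by (auto simp: A_def)
    then have "subset.chain {I. ideal I R} C" using C by (simp add: pred_on.chain_def)
    then have "\<Union>C \<in> C" by (rule ideal_chain_is_trivial[OF False])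
    then show ?thesis using CA by (intro bexI[of _ "\<Union>C"]) auto
  qed
  have "\<exists>M\<in>A. \<forall>K\<in>A. M \<subseteq> K \<longrightarrow> K = M"
    by (rule subset_Zorn) (rule upper)
  then obtain M where "M \<in> A" "\<forall>K\<in>A. M \<subseteq> K \<longrightarrow> K = M" by (elim bexE)
  then have M: "M \<in> A" "\<And>K. \<lbrakk>K \<in> A; M \<subseteq> K\<rbrakk> \<Longrightarrow> K = M" by simp_all
  show ?thesis
  proof (rule that)
    show "M \<in> F" "I \<subseteq> M" using M(1) by (simp_all add: A_def)
    fix J assume "J \<in> F" "M \<subseteq> J"
    then have "J \<in> A" using \<open>I \<subseteq> M\<close> by (simp add: A_def)
    then show "J = M" using \<open>M \<subseteq> J\<close> M(2) by simp
  qed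
qed

definition colon :: "('a, 'b) ring_scheme \<Rightarrow> 'a set \<Rightarrow> 'a \<Rightarrow> 'a set" where
  "colon R J y = {r \<in> carrier R. r \<otimes>\<^bsub>R\<^esub> y \<in> J}"

lemma (in cring) colon_ideal:
  assumes "ideal J R" "y \<in> carrier R"
  shows "ideal (colon R J y) R"
proof -
  interpret J: ideal J R by fact
  show ?thesis
    by (rule idealI_cring)
       (use assms in \<open>auto simp: colon_def l_distr m_assoc intro: J.I_l_closed\<close>)
qed

text \<open>A prime containing none of finitely many ideals does not contain their product, hence not
  their intersection.\<close>

lemma (in cring) prime_avoids_inter:
  assumes Q: "primeideal Q R" and "finite A" and I: "ideal I R" "\<not> I \<subseteq> Q"
    and A: "\<And>P. P \<in> A \<Longrightarrow> ideal P R \<and> \<not> P \<subseteq> Q"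
  obtains c where "c \<in> I" "c \<notin> Q" "\<And>P. P \<in> A \<Longrightarrow> c \<in> P"
proof -
  interpret Q: primeideal Q R by fact
  have "\<exists>c \<in> I - Q. \<forall>P\<in>A. c \<in> P"
    using \<open>finite A\<close> A
  proof (induction A)
    case empty then show ?case using I by auto
  next
    case (insert P A)
    then obtain c where c: "c \<in> I - Q" "\<forall>P\<in>A. c \<in> P" by auto
    from insert.prems obtain d where d: "d \<in> P" "d \<notin> Q" by blast
    have dc: "d \<in> carrier R" "c \<in> carrier R"
      using d(1) c insert.prems[of P] I(1) by (auto simp: ideal_carrier)
    have "d \<otimes> c \<in> I - Q" using c d dc Q.I_prime ideal.I_l_closed[OF I(1)] by blast
    moreover have "d \<otimes> c \<in> P'" if "P' \<in> insert P A" for P'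
    proof (cases "P' = P")
      case True
      then show ?thesis using d(1) dc insert.prems[of P] ideal.I_r_closed by fastforce
    next
      case False
      then show ?thesis using that c dc insert.prems[of P'] ideal.I_l_closed by fastforce
    qed
    ultimately show ?case by blast
  qed
  then show ?thesis using that by blast
qed

text \<open>Prime avoidance. Incomparability of the primes makes the induction elementary: if \<open>b\<close> avoids
  all primes in \<open>A\<close> but lies in \<open>Q\<close>, add to it an element of \<open>I\<close> outside \<open>Q\<close> that lies in
  every prime in \<open>A\<close>.\<close>

lemma (in cring) prime_avoidance_antichain:
  assumes "finite A" and A: "\<And>P. P \<in> A \<Longrightarrow> primeideal P R"
    and anti: "\<And>P Q. \<lbrakk>P \<in> A; Q \<in> A; P \<subseteq> Q\<rbrakk> \<Longrightarrow> P = Q"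
    and I: "ideal I R" "\<And>P. P \<in> A \<Longrightarrow> \<not> I \<subseteq> P"
  obtains b where "b \<in> I" "\<And>P. P \<in> A \<Longrightarrow> b \<notin> P"
proof -
  interpret I: ideal I R by fact
  have "\<exists>b\<in>I. \<forall>P\<in>A. b \<notin> P"
    using \<open>finite A\<close> A anti I(2)
  proof (induction A)
    case empty then show ?case using ideal_zero[OF I(1)] by blast
  next
    case (insert Q A)
    then obtain b where b: "b \<in> I" "\<forall>P\<in>A. b \<notin> P" by auto
    interpret Q: primeideal Q R using insert.prems by auto
    show ?case
    proof (cases "b \<in> Q")
      case False then show ?thesis using b by auto
    next
      case True
      have "\<exists>c. c \<in> I \<and> c \<notin> Q \<and> (\<forall>P\<in>A. c \<in> P)"
      proof (rule prime_avoids_inter[of Q A I])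
        show "ideal P R \<and> \<not> P \<subseteq> Q" if "P \<in> A" for P
          using insert.hyps insert.prems(1)[of P] insert.prems(2)[of P Q] that
          by (auto simp: primeideal_def)
      qed (use insert Q.primeideal I in auto)
      then obtain c where c: "c \<in> I" "c \<notin> Q" "\<forall>P\<in>A. c \<in> P" by blast
      have carr: "b \<in> carrier R" "c \<in> carrier R" using b c by auto
      have "b \<oplus> c \<in> I" using b c by auto
      moreover have "b \<oplus> c \<notin> Q"
      proof
        assume "b \<oplus> c \<in> Q"
        then have "(b \<oplus> c) \<ominus> b \<in> Q" using True by (simp add: Q.a_closed a_minus_def)
        moreover have "(b \<oplus> c) \<ominus> b = c" using carr by algebra
        ultimately show False using c by simp
      qed
      moreover have "b \<oplus> c \<notin> P" if "P \<in> A" for P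
      proof
        interpret P: primeideal P R using insert.prems that by auto
        assume "b \<oplus> c \<in> P"
        then have "(b \<oplus> c) \<ominus> c \<in> P" using c that by (simp add: P.a_closed a_minus_def)
        moreover have "(b \<oplus> c) \<ominus> c = b" using carr by algebra
        ultimately show False using b that by simp
      qed
      ultimately show ?thesis by blast
    qed
  qed
  then show ?thesis using that by blast
qed

section \<open>Common annihilators of zero divisors\<close>

text \<open>An ideal of a noetherian ring that consists of zero divisors on a finitely generated module
  annihilates a single nonzero element of that module. Here the module is \<open>S\<inverse>(R/J)\<close>, in
  which the class of \<open>y\<close> is nonzero iff \<open>(J : y)\<close> misses \<open>S\<close>, and which never has to be
  constructed. The ideals \<open>(J : y)\<close> maximal among those missing \<open>S\<close> are prime. There are only
  finitely many: if \<open>y n\<close> depends linearly on \<open>y 0, \<dots>, y (n - 1)\<close>, the intersection of the earlier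
  \<open>(J : y i)\<close> lies in \<open>(J : y n)\<close>, so one of them does. Prime avoidance finishes the proof.

  It is applied with \<open>S = {1}\<close> and \<open>J = 0\<close> to find nonzerodivisors in \<open>R\<close>, and with \<open>J\<close>
  principal and \<open>S\<close> the complement of a prime to find regular sequences in its localization.\<close>

lemma (in noetherian_cring) common_zerodivisor_witness:
  assumes J: "ideal J R" and I: "ideal I R"
    and S: "S \<subseteq> carrier R" "\<one> \<in> S" "\<And>s t. \<lbrakk>s \<in> S; t \<in> S\<rbrakk> \<Longrightarrow> s \<otimes> t \<in> S"
    and zd: "\<And>b. b \<in> I \<Longrightarrow> \<exists>y \<in> carrier R. b \<in> colon R J y \<and> colon R J y \<inter> S = {}"
  shows "\<exists>y \<in> carrier R. I \<subseteq> colon R J y \<and> colon R J y \<inter> S = {}"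
proof -
  interpret J: ideal J R by fact
  define F where "F = {colon R J y | y. y \<in> carrier R \<and> colon R J y \<inter> S = {}}"
  define Mx where "Mx = {M \<in> F. \<forall>K\<in>F. M \<subseteq> K \<longrightarrow> K = M}"
  have F_ideal: "ideal K R" if "K \<in> F" for K using that colon_ideal[OF J] by (auto simp: F_def)
  have Mx_prime: "primeideal M R" if M: "M \<in> Mx" for M
  proof (rule primeidealI)
    from M obtain y where y: "y \<in> carrier R" "M = colon R J y" "M \<inter> S = {}"
      by (auto simp: Mx_def F_def)
    have max: "K = M" if "K \<in> F" "M \<subseteq> K" for K using M that by (auto simp: Mx_def)
    show "ideal M R" using M F_ideal by (auto simp: Mx_def)
    show "carrier R \<noteq> M" using y(3) S by auto
    fix a b assume ab: "a \<in> carrier R" "b \<in> carrier R" "a \<otimes> b \<in> M"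
    have sub: "M \<subseteq> colon R J (y \<otimes> c)" if c: "c \<in> carrier R" for c
    proof
      fix r assume "r \<in> M"
      then have r: "r \<in> carrier R" "r \<otimes> y \<in> J" using y(2) by (auto simp: colon_def)
      have "r \<otimes> (y \<otimes> c) = c \<otimes> (r \<otimes> y)" using r c y(1) by algebra
      then show "r \<in> colon R J (y \<otimes> c)"
        using r c J.I_l_closed[of "r \<otimes> y" c] by (auto simp: colon_def)
    qed
    show "a \<in> M \<or> b \<in> M"
    proof (cases "colon R J (y \<otimes> b) \<inter> S = {}")
      case True
      then have "colon R J (y \<otimes> b) \<in> F" using ab y(1) by (auto simp: F_def)
      then have "colon R J (y \<otimes> b) = M" using max sub ab by simp
      moreover have "a \<otimes> (y \<otimes> b) = (a \<otimes> b) \<otimes> y" using ab y(1) by algebra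
      then have "a \<in> colon R J (y \<otimes> b)" using ab y(2) by (auto simp: colon_def)
      ultimately show ?thesis by simp
    next
      case False
      then obtain u where u: "u \<in> S" "u \<otimes> (y \<otimes> b) \<in> J" by (auto simp: colon_def)
      then have uR: "u \<in> carrier R" using S by auto
      have "colon R J (y \<otimes> u) \<inter> S = {}"
      proof -
        have False if v: "v \<in> S" "v \<in> colon R J (y \<otimes> u)" for v
        proof -
          have vR: "v \<in> carrier R" using v S by auto
          have "v \<otimes> (y \<otimes> u) = (v \<otimes> u) \<otimes> y" using vR uR y(1) by algebra
          then have "v \<otimes> u \<in> M" using v vR uR y(2) by (auto simp: colon_def)
          then show False using S(3)[OF v(1) u(1)] y(3) by blast
        qed
        then show ?thesis by blast
      qed
      then have "colon R J (y \<otimes> u) \<in> F" using uR y(1) by (auto simp: F_def)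
      then have "colon R J (y \<otimes> u) = M" using max sub uR by simp
      moreover have "b \<otimes> (y \<otimes> u) = u \<otimes> (y \<otimes> b)" using ab uR y(1) by algebra
      then have "b \<in> colon R J (y \<otimes> u)" using u ab by (auto simp: colon_def)
      ultimately show ?thesis by simp
    qed
  qed (rule is_cring)
  have anti: "P = Q" if "P \<in> Mx" "Q \<in> Mx" "P \<subseteq> Q" for P Q
    using that by (auto simp: Mx_def)
  have "finite Mx"
  proof (rule ccontr)
    assume "infinite Mx"
    then obtain M :: "nat \<Rightarrow> 'a set" where M: "inj M" "range M \<subseteq> Mx"
      using infinite_countable_subset by blast
    have "\<forall>i. \<exists>y. y \<in> carrier R \<and> M i = colon R J y"
    proof
      fix i
      have "M i \<in> F" using M(2) by (auto simp: Mx_def)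
      then show "\<exists>y. y \<in> carrier R \<and> M i = colon R J y" unfolding F_def by blast
    qed
    then obtain y where y: "\<And>i. y i \<in> carrier R" "\<And>i. M i = colon R J (y i)" by metis
    obtain n where n: "y n \<in> prefix_ideal R y n"
      using sequence_dependent[of y] y(1) by blast
    have MR: "M i \<subseteq> carrier R" for i by (auto simp: y(2) colon_def)
    have comb: "r \<otimes> v \<in> J" if "v \<in> prefix_ideal R y m" "r \<in> carrier R" "\<And>i. i < m \<Longrightarrow> r \<in> M i" for v r m
      using that
    proof (induction m arbitrary: v)
      case 0 then show ?case using J.zero_closed by auto
    next
      case (Suc m)
      then obtain v' s where v: "v = v' \<oplus> s \<otimes> y m" "v' \<in> prefix_ideal R y m" "s \<in> carrier R" by auto
      have "v' \<in> carrier R"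
        using v prefix_ideal_ideal[of y m] y(1) ideal_carrier by blast
      then have "r \<otimes> v = r \<otimes> v' \<oplus> s \<otimes> (r \<otimes> y m)" using v Suc.prems(2) y(1)[of m] by algebra
      moreover have "r \<otimes> v' \<in> J" using Suc v by auto
      moreover have "r \<otimes> y m \<in> J" using Suc.prems(3)[of m] y(2) by (auto simp: colon_def)
      ultimately show ?case using v(3) by (auto intro: J.I_l_closed)
    qed
    have Mn: "M n \<in> Mx" using M by auto
    obtain c where "c \<in> carrier R" "c \<notin> M n" "\<And>P. P \<in> M ` {..<n} \<Longrightarrow> c \<in> P"
    proof (rule prime_avoids_inter[OF Mx_prime[OF Mn], of "M ` {..<n}" "carrier R"])
      show "\<not> carrier R \<subseteq> M n" using Mx_prime[OF Mn] MR
        by (metis primeideal.I_notcarr subset_antisym)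
      show "ideal P R \<and> \<not> P \<subseteq> M n" if "P \<in> M ` {..<n}" for P
      proof -
        from that obtain i where i: "i < n" "P = M i" by auto
        have "M i \<in> Mx" using M by auto
        moreover have "M i \<noteq> M n" using M(1) i by (auto dest: injD)
        ultimately show ?thesis using i anti[OF _ Mn] F_ideal by (auto simp: Mx_def)
      qed
    qed (auto simp: oneideal)
    then have "c \<otimes> y n \<in> J" using comb[OF n] by auto
    then show False using \<open>c \<in> carrier R\<close> \<open>c \<notin> M n\<close> y(2) by (auto simp: colon_def)
  qed
  have "\<exists>M\<in>Mx. I \<subseteq> M"
  proof (rule ccontr)
    assume "\<not> ?thesis"
    then obtain b where b: "b \<in> I" "\<And>P. P \<in> Mx \<Longrightarrow> b \<notin> P"
      using prime_avoidance_antichain[OF \<open>finite Mx\<close> Mx_prime anti I] by blast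
    from zd[OF b(1)] obtain y where y: "y \<in> carrier R" "b \<in> colon R J y" "colon R J y \<inter> S = {}"
      by blast
    then have yF: "colon R J y \<in> F" by (auto simp: F_def)
    obtain M where M: "M \<in> F" "colon R J y \<subseteq> M" "\<And>K. \<lbrakk>K \<in> F; M \<subseteq> K\<rbrakk> \<Longrightarrow> K = M"
      using exists_maximal_ideal_in_family[OF yF F_ideal] by metis
    then have "M \<in> Mx" unfolding Mx_def by blast
    then show False using b(2) M(2) y(2) by blast
  qed
  then obtain M where "M \<in> F" "I \<subseteq> M" by (auto simp: Mx_def)
  then show ?thesis unfolding F_def by blast
qed

text \<open>As \<open>J\<close> is finitely generated, multipliers for the individual elements of \<open>J\<close> can be
  replaced by the product of those for its generators.\<close>

lemma (in noetherian_cring) uniform_multiplier: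
  assumes J: "ideal J R" and K: "ideal K R"
    and S: "\<one> \<in> S" "S \<subseteq> carrier R" "\<And>s t. \<lbrakk>s \<in> S; t \<in> S\<rbrakk> \<Longrightarrow> s \<otimes> t \<in> S"
    and ex: "\<And>y. y \<in> J \<Longrightarrow> \<exists>d\<in>S. d \<otimes> y \<in> K"
  shows "\<exists>d\<in>S. \<forall>y\<in>J. d \<otimes> y \<in> K"
proof -
  interpret K: ideal K R by fact
  obtain A where A: "A \<subseteq> carrier R" "finite A" "J = Idl A" using finetely_gen[OF J] by blast
  have AJ: "A \<subseteq> J" unfolding A(3) by (rule genideal_self[OF A(1)])
  have "\<exists>d\<in>S. \<forall>y\<in>A. d \<otimes> y \<in> K"
    using A(2) AJ
  proof (induction A)
    case empty then show ?case using S(1) by blast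
  next
    case (insert y A)
    then obtain d where d: "d \<in> S" "\<forall>y\<in>A. d \<otimes> y \<in> K" by auto
    obtain e where e: "e \<in> S" "e \<otimes> y \<in> K" using ex[of y] insert.prems by auto
    have carr: "d \<in> carrier R" "e \<in> carrier R" using d e S(2) by auto
    have "(d \<otimes> e) \<otimes> y' \<in> K" if y': "y' \<in> insert y A" for y'
    proof -
      have y'R: "y' \<in> carrier R" using y' insert.prems J ideal_carrier by blast
      show ?thesis
      proof (cases "y' = y")
        case True
        have "d \<otimes> (e \<otimes> y) \<in> K" by (rule K.I_l_closed[OF e(2) carr(1)])
        then show ?thesis using True y'R carr by (simp add: m_assoc)
      next
        case False
        then have "d \<otimes> y' \<in> K" using d(2) y' by blast
        then have "e \<otimes> (d \<otimes> y') \<in> K" by (rule K.I_l_closed[OF _ carr(2)])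
        moreover have "e \<otimes> (d \<otimes> y') = (d \<otimes> e) \<otimes> y'" using y'R carr by algebra
        ultimately show ?thesis by simp
      qed
    qed
    then show ?case using S(3)[OF d(1) e(1)] by blast
  qed
  then obtain d where d: "d \<in> S" "\<forall>y\<in>A. d \<otimes> y \<in> K" by blast
  have dR: "d \<in> carrier R" using d S by auto
  have "A \<subseteq> colon R K d" using d(2) A(1) dR by (auto simp: colon_def m_comm subset_iff)
  then have "J \<subseteq> colon R K d" unfolding A(3) by (rule genideal_minimal[OF colon_ideal[OF K dR]])
  then have "d \<otimes> y \<in> K" if "y \<in> J" for y
    using that dR by (auto simp: colon_def m_comm)
  then show ?thesis using d(1) by blast
qed

section \<open>Nonzerodivisors, height and denominator ideals\<close>

lemma (in cring) nonzerodivisors_cancel: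
  assumes "a \<in> nonzerodivisors R" "b \<in> carrier R" "c \<in> carrier R" "a \<otimes> b = a \<otimes> c"
  shows "b = c"
proof -
  have a: "a \<in> carrier R" using assms(1) by (simp add: nonzerodivisors_def)
  have "a \<otimes> (b \<ominus> c) = a \<otimes> b \<ominus> a \<otimes> c" using a assms by algebra
  also have "\<dots> = \<zero>" using a assms by (simp add: r_neg a_minus_def)
  finally have "b \<ominus> c = \<zero>" using assms by (auto simp: nonzerodivisors_def)
  then show ?thesis using assms by simp
qed

lemma (in cring) nonzerodivisors_closed:
  "\<one> \<in> nonzerodivisors R"
  "\<lbrakk>a \<in> nonzerodivisors R; b \<in> nonzerodivisors R\<rbrakk> \<Longrightarrow> a \<otimes> b \<in> nonzerodivisors R"
proof -
  show "\<one> \<in> nonzerodivisors R" by (simp add: nonzerodivisors_def)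
  assume ab: "a \<in> nonzerodivisors R" "b \<in> nonzerodivisors R"
  have carr: "a \<in> carrier R" "b \<in> carrier R" using ab by (simp_all add: nonzerodivisors_def)
  have "c = \<zero>" if c: "c \<in> carrier R" "a \<otimes> b \<otimes> c = \<zero>" for c
  proof -
    have "a \<otimes> (b \<otimes> c) = \<zero>" using c carr by (simp add: m_assoc)
    then have "b \<otimes> c = \<zero>" using ab(1) c carr unfolding nonzerodivisors_def by blast
    then show ?thesis using ab(2) c unfolding nonzerodivisors_def by blast
  qed
  then show "a \<otimes> b \<in> nonzerodivisors R" using carr unfolding nonzerodivisors_def by blast
qed

lemma height_ge_chain:
  assumes "0 < k" "enat k \<le> height R P"
  obtains c where "\<And>i. i \<le> k \<Longrightarrow> c i \<in> Spec R" "\<And>i. i < k \<Longrightarrow> c i \<subset> c (Suc i)" "c k = P"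
proof -
  define N where "N = {n. \<exists>c. (\<forall>i\<le>n. c i \<in> Spec R) \<and> (\<forall>i<n. c i \<subset> c (Suc i)) \<and> c n = P}"
  have "\<exists>n\<in>N. k \<le> n"
  proof (rule ccontr)
    assume "\<not> ?thesis"
    then have "enat n \<le> enat (k - 1)" if "n \<in> N" for n
      using that by (metis Suc_diff_1 assms(1) enat_ord_simps(1) less_Suc_eq_le not_le)
    then have "height R P \<le> enat (k - 1)"
      unfolding height_def N_def[symmetric] by (rule SUP_least)
    then have "enat k \<le> enat (k - 1)" using assms(2) by (rule order_trans[rotated])
    then show False using assms(1) by simp
  qed
  then obtain n c where n: "k \<le> n" "\<And>i. i \<le> n \<Longrightarrow> c i \<in> Spec R"
    "\<And>i. i < n \<Longrightarrow> c i \<subset> c (Suc i)" "c n = P" unfolding N_def by blast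
  show ?thesis
  proof (rule that[of "\<lambda>i. c (i + (n - k))"])
    show "c (i + (n - k)) \<in> Spec R" if "i \<le> k" for i using n(1) n(2)[of "i + (n - k)"] that by simp
    show "c (i + (n - k)) \<subset> c (Suc i + (n - k))" if "i < k" for i
      using n(1) n(3)[of "i + (n - k)"] that by simp
    show "c (k + (n - k)) = P" using n(1,4) by simp
  qed
qed

lemma height_1D:
  assumes "enat 1 \<le> height R P"
  obtains P0 where "P0 \<in> Spec R" "P0 \<subset> P"
proof -
  obtain c where c: "\<And>i. i \<le> 1 \<Longrightarrow> c i \<in> Spec R" "\<And>i. i < 1 \<Longrightarrow> c i \<subset> c (Suc i)" "c 1 = P"
    using height_ge_chain[OF _ assms] by (metis zero_less_one)
  show ?thesis by (rule that[of "c 0"]) (use c(1)[of 0] c(2)[of 0] c(3) in auto)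
qed

lemma height_2D:
  assumes "enat 2 \<le> height R P"
  obtains P0 P1 where "P0 \<in> Spec R" "P1 \<in> Spec R" "P0 \<subset> P1" "P1 \<subset> P"
proof -
  obtain c where c: "\<And>i. i \<le> 2 \<Longrightarrow> c i \<in> Spec R" "\<And>i. i < 2 \<Longrightarrow> c i \<subset> c (Suc i)" "c 2 = P"
    using height_ge_chain[OF _ assms] by (metis zero_less_numeral)
  show ?thesis
    by (rule that[of "c 0" "c 1"])
       (use c(1)[of 0] c(1)[of 1] c(2)[of 0] c(2)[of 1] c(3) in \<open>simp_all add: numeral_2_eq_2\<close>)
qed

locale reduced_noetherian_cring = noetherian_cring +
  assumes reduced: "reduced_ring R"

text \<open>If \<open>P\<close> had no nonzerodivisor, some \<open>y \<noteq> 0\<close> would satisfy \<open>y P = 0\<close>. Then \<open>y\<close>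
  cannot lie in \<open>P0\<close>, as that would give \<open>y\<^sup>2 = 0\<close>, and so \<open>y P \<subseteq> P0\<close> forces \<open>P \<subseteq> P0\<close>.\<close>

lemma (in reduced_noetherian_cring) nonminimal_prime_contains_nonzerodivisor:
  assumes P: "primeideal P R" and P0: "primeideal P0 R" "P0 \<subset> P"
  obtains x where "x \<in> P" "x \<in> nonzerodivisors R"
proof -
  have "\<exists>x \<in> P. x \<in> nonzerodivisors R"
  proof (rule ccontr)
    assume no: "\<not> ?thesis"
    interpret P: primeideal P R by fact
    interpret P0: primeideal P0 R by fact
    have zd: "\<exists>y \<in> carrier R. b \<in> colon R {\<zero>} y \<and> colon R {\<zero>} y \<inter> {\<one>} = {}" if b: "b \<in> P" for b
    proof -
      have "b \<notin> nonzerodivisors R" using no b by blast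
      then obtain y where "y \<in> carrier R" "b \<otimes> y = \<zero>" "y \<noteq> \<zero>"
        using b by (auto simp: nonzerodivisors_def)
      then show ?thesis using b by (auto simp: colon_def)
    qed
    have "\<exists>y \<in> carrier R. P \<subseteq> colon R {\<zero>} y \<and> colon R {\<zero>} y \<inter> {\<one>} = {}"
      by (rule common_zerodivisor_witness[OF zeroideal P.is_ideal _ _ _ zd]) auto
    then obtain y where y: "y \<in> carrier R" "P \<subseteq> colon R {\<zero>} y" "colon R {\<zero>} y \<inter> {\<one>} = {}"
      by blast
    have ann: "b \<otimes> y = \<zero>" if "b \<in> P" for b using that y by (auto simp: colon_def)
    have "y \<noteq> \<zero>" using y by (auto simp: colon_def)
    have "y \<notin> P0"
    proof
      assume "y \<in> P0"
      then have "y \<otimes> y = \<zero>" using ann P0 by auto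
      then have "y [^] (2::nat) = \<zero>" using y by (simp add: numeral_2_eq_2)
      then show False using reduced y \<open>y \<noteq> \<zero>\<close> unfolding reduced_ring_def by blast
    qed
    moreover obtain b where b: "b \<in> P" "b \<notin> P0" using P0 by auto
    moreover have "b \<otimes> y \<in> P0" using ann[OF b(1)] ideal_zero[OF P0.is_ideal] by simp
    ultimately show False using P0.I_prime[of b y] y(1) by auto
  qed
  then show ?thesis using that by blast
qed

text \<open>The case of Krull's principal ideal theorem in which \<open>p\<close> generates \<open>P\<close> in the localization
  at \<open>P\<close>: no prime lies strictly between. Since \<open>p \<notin> P1\<close>, an element \<open>x\<close> of \<open>P1\<close> can be divided by
  \<open>p\<close> without end, up to factors \<open>u\<close>, inside \<open>P1\<close>. A linear dependence between the quotients
  then yields \<open>d \<notin> P\<close> with \<open>d x = 0\<close>.\<close>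

lemma (in noetherian_cring) locally_principal_prime_height:
  assumes P: "primeideal P R" and P1: "primeideal P1 R" "P1 \<subset> P" and P0: "primeideal P0 R" "P0 \<subseteq> P"
    and p: "p \<in> P" and u: "u \<in> carrier R" "u \<notin> P"
    and gen: "\<And>a. a \<in> P \<Longrightarrow> \<exists>r \<in> carrier R. u \<otimes> a = p \<otimes> r"
  shows "P1 \<subseteq> P0"
proof -
  interpret P: primeideal P R by fact
  interpret P0: primeideal P0 R by (rule P0)
  interpret P1: primeideal P1 R by fact
  have pR: "p \<in> carrier R" using p by auto
  have pP1: "p \<notin> P1"
  proof
    assume "p \<in> P1"
    have "a \<in> P1" if a: "a \<in> P" for a
    proof -
      obtain r where "r \<in> carrier R" "u \<otimes> a = p \<otimes> r" using gen[OF a] by auto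
      then have "u \<otimes> a \<in> P1" using \<open>p \<in> P1\<close> P1.I_r_closed by auto
      then show ?thesis using P1.I_prime[of u a] u a P1(2) by auto
    qed
    then show False using P1(2) by auto
  qed
  have step: "\<exists>b. b \<in> P1 \<and> u \<otimes> a = p \<otimes> b" if a: "a \<in> P1" for a
  proof -
    obtain r where r: "r \<in> carrier R" "u \<otimes> a = p \<otimes> r" using gen[of a] a P1(2) by auto
    have "p \<otimes> r \<in> P1" using P1.I_l_closed[OF a u(1)] r(2) by simp
    then have "r \<in> P1" using P1.I_prime[of p r] pR pP1 r by auto
    then show ?thesis using r by auto
  qed
  have "x \<in> P0" if x: "x \<in> P1" for x
  proof -
    obtain w where w: "w 0 = x" "\<And>n. w n \<in> P1 \<and> u \<otimes> w n = p \<otimes> w (Suc n)"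
    proof -
      obtain f where f: "\<And>a. a \<in> P1 \<Longrightarrow> f a \<in> P1 \<and> u \<otimes> a = p \<otimes> f a" using step by metis
      define w where "w = rec_nat x (\<lambda>_. f)"
      have wP: "w n \<in> P1" for n by (induction n) (auto simp: w_def x f)
      then show ?thesis using f that[of w] by (simp add: w_def)
    qed
    have wR: "w n \<in> carrier R" for n using w(2) P1.Icarr by blast
    obtain n where n: "w n \<in> prefix_ideal R w n" using sequence_dependent[of w] wR by blast
    \<comment> \<open>Clearing denominators turns each earlier term into a multiple of \<open>w m\<close> by a power of \<open>p\<close>;
      the exponent is positive, which is why \<open>e\<close> lands in \<open>P\<close>.\<close>
    have red: "\<exists>e\<in>P. u [^] m \<otimes> v = e \<otimes> w m" if "v \<in> prefix_ideal R w m" for v m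
      using that
    proof (induction m arbitrary: v)
      case 0 then show ?case using wR ideal_zero[OF P.is_ideal] by (intro bexI[of _ "\<zero>"]) auto
    next
      case (Suc m)
      then obtain v' r where v: "v = v' \<oplus> r \<otimes> w m" "v' \<in> prefix_ideal R w m" "r \<in> carrier R" by auto
      obtain e where e: "e \<in> P" "u [^] m \<otimes> v' = e \<otimes> w m" using Suc.IH v by blast
      have v'R: "v' \<in> carrier R" using v prefix_ideal_ideal[of w m] wR ideal_carrier by blast
      have carr: "e \<in> carrier R" "u [^] m \<in> carrier R" "w m \<in> carrier R" "w (Suc m) \<in> carrier R"
        using e u wR by auto
      have "u [^] Suc m \<otimes> v = u \<otimes> (u [^] m \<otimes> v') \<oplus> (u [^] m \<otimes> r) \<otimes> (u \<otimes> w m)"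
        using carr u(1) v'R v(1,3) by (simp add: r_distr m_ac)
      also have "\<dots> = (e \<oplus> u [^] m \<otimes> r) \<otimes> (u \<otimes> w m)"
        using carr u(1) v(3) unfolding e(2) by algebra
      also have "\<dots> = ((e \<oplus> u [^] m \<otimes> r) \<otimes> p) \<otimes> w (Suc m)"
        using w(2)[of m] carr v(3) pR by (simp add: m_assoc)
      finally have *: "u [^] Suc m \<otimes> v = ((e \<oplus> u [^] m \<otimes> r) \<otimes> p) \<otimes> w (Suc m)" .
      have "(e \<oplus> u [^] m \<otimes> r) \<otimes> p \<in> P" by (rule P.I_l_closed[OF p]) (use carr v(3) in simp)
      with * show ?case by blast
    qed
    have pow: "u [^] m \<otimes> x = p [^] m \<otimes> w m" for m
    proof (induction m)
      case 0 then show ?case using w(1) wR[of 0] by simp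
    next
      case (Suc m)
      have xR: "x \<in> carrier R" using x by auto
      have "u [^] Suc m \<otimes> x = u \<otimes> (u [^] m \<otimes> x)" using u(1) xR by (simp add: m_ac)
      also have "\<dots> = p [^] m \<otimes> (u \<otimes> w m)" using Suc u(1) pR wR[of m] by (simp add: m_ac)
      also have "\<dots> = p [^] Suc m \<otimes> w (Suc m)" using w(2)[of m] pR wR[of "Suc m"] by (simp add: m_ac)
      finally show ?case .
    qed
    obtain e where e: "e \<in> P" "u [^] n \<otimes> w n = e \<otimes> w n" using red[OF n] by blast
    have carr: "u [^] n \<in> carrier R" "e \<in> carrier R" "p [^] n \<in> carrier R" "x \<in> carrier R"
      using e u pR x by auto
    define d where "d = u [^] n \<ominus> e"
    have dR: "d \<in> carrier R" using carr by (simp add: d_def)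
    have "u [^] m \<notin> P" for m :: nat
    proof (induction m)
      case 0 show ?case using P.I_notcarr P.one_imp_carrier by auto
    next
      case (Suc m) then show ?case using P.I_prime[of "u [^] m" u] u by auto
    qed
    then have un: "u [^] n \<notin> P" .
    have dP: "d \<notin> P"
    proof
      assume "d \<in> P"
      then have "d \<oplus> e \<in> P" using e ideal_add P.is_ideal by blast
      moreover have "d \<oplus> e = u [^] n" unfolding d_def using carr by algebra
      ultimately show False using un by simp
    qed
    have "d \<otimes> w n = u [^] n \<otimes> w n \<ominus> e \<otimes> w n"
      unfolding d_def using carr wR[of n] by algebra
    then have dw: "d \<otimes> w n = \<zero>" using e(2) carr wR[of n] by (simp add: a_minus_def r_neg)
    have "(d \<otimes> u [^] n) \<otimes> x = d \<otimes> (p [^] n \<otimes> w n)"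
      using pow[of n] dR carr by (simp add: m_assoc)
    also have "\<dots> = p [^] n \<otimes> (d \<otimes> w n)"
      using dR carr wR[of n] by (simp add: m_lcomm)
    finally have "(d \<otimes> u [^] n) \<otimes> x = p [^] n \<otimes> (d \<otimes> w n)" .
    then have "(d \<otimes> u [^] n) \<otimes> x \<in> P0" using dw carr ideal_zero[OF P0.is_ideal] by simp
    then have "d \<in> P0 \<or> u [^] n \<in> P0 \<or> x \<in> P0"
      using P0.I_prime[of "d \<otimes> u [^] n" x] P0.I_prime[of d "u [^] n"] dR carr by auto
    then show "x \<in> P0" using dP un P0(2) by auto
  qed
  then show ?thesis by auto
qed

text \<open>The denominators of the fraction \<open>y / x\<close>. For prime \<open>P\<close> this says that \<open>P\<close> is associated to
  \<open>Q/R\<close>, where \<open>Q\<close> is the total quotient ring, but it is phrased within \<open>R\<close>.\<close>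

definition denominator_ideal :: "('a, 'b) ring_scheme \<Rightarrow> 'a set \<Rightarrow> bool" where
  "denominator_ideal R P \<longleftrightarrow>
     (\<exists>x \<in> nonzerodivisors R. \<exists>y \<in> carrier R. P = {r \<in> carrier R. \<exists>z \<in> carrier R. r \<otimes>\<^bsub>R\<^esub> y = x \<otimes>\<^bsub>R\<^esub> z})"

section \<open>Rings of fractions\<close>

lemma UN_const: "p \<in> A \<Longrightarrow> (\<And>p. p \<in> A \<Longrightarrow> g p = z) \<Longrightarrow> (\<Union>p\<in>A. g p) = z"
  by auto

locale mult_submonoid = cring R for R (structure) +
  fixes S
  assumes S_carrier: "S \<subseteq> carrier R" and S_one: "\<one> \<in> S"
    and S_mult: "\<lbrakk>s \<in> S; t \<in> S\<rbrakk> \<Longrightarrow> s \<otimes> t \<in> S"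
begin

abbreviation "L \<equiv> localization R S"

lemma S_in: "s \<in> S \<Longrightarrow> s \<in> carrier R" using S_carrier by auto

lemma frac_rel_iff:
  "((a, s), (b, t)) \<in> frac_rel R S \<longleftrightarrow>
     a \<in> carrier R \<and> s \<in> S \<and> b \<in> carrier R \<and> t \<in> S \<and> (\<exists>u\<in>S. u \<otimes> (t \<otimes> a \<ominus> s \<otimes> b) = \<zero>)"
  by (auto simp: frac_rel_def)

lemma equiv_frac_rel: "equiv (carrier R \<times> S) (frac_rel R S)"
proof (rule equivI)
  show "frac_rel R S \<subseteq> (carrier R \<times> S) \<times> (carrier R \<times> S)" by (auto simp: frac_rel_def)
  show "refl_on (carrier R \<times> S) (frac_rel R S)"
  proof (rule refl_onI)
    fix p assume "p \<in> carrier R \<times> S"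
    then obtain a s where p: "p = (a, s)" "a \<in> carrier R" "s \<in> S" by auto
    have "s \<otimes> a \<ominus> s \<otimes> a = \<zero>" using p S_in by (simp add: r_neg a_minus_def)
    then have "\<one> \<otimes> (s \<otimes> a \<ominus> s \<otimes> a) = \<zero>" by simp
    then show "(p, p) \<in> frac_rel R S" unfolding p(1) frac_rel_iff using p S_one by blast
  qed
  show "sym (frac_rel R S)"
  proof (rule symI)
    fix p q assume pq: "(p, q) \<in> frac_rel R S"
    obtain a s b t where ab: "p = (a, s)" "q = (b, t)" by (cases p; cases q)
    from pq obtain u where u: "a \<in> carrier R" "s \<in> S" "b \<in> carrier R" "t \<in> S" "u \<in> S"
      "u \<otimes> (t \<otimes> a \<ominus> s \<otimes> b) = \<zero>" unfolding ab frac_rel_iff by blast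
    have c: "s \<in> carrier R" "t \<in> carrier R" "u \<in> carrier R" using u S_in by auto
    have "u \<otimes> (s \<otimes> b \<ominus> t \<otimes> a) = \<ominus> (u \<otimes> (t \<otimes> a \<ominus> s \<otimes> b))" using c u(1,3) by algebra
    then have "u \<otimes> (s \<otimes> b \<ominus> t \<otimes> a) = \<zero>" using u by simp
    then show "(q, p) \<in> frac_rel R S" unfolding ab frac_rel_iff using u by blast
  qed
  show "trans (frac_rel R S)"
  proof (rule transI)
    fix p q z assume pq: "(p, q) \<in> frac_rel R S" "(q, z) \<in> frac_rel R S"
    obtain a s b t c r where ab: "p = (a, s)" "q = (b, t)" "z = (c, r)" by (cases p; cases q; cases z)
    from pq(1) obtain u where u: "a \<in> carrier R" "s \<in> S" "b \<in> carrier R" "t \<in> S" "u \<in> S"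
      "u \<otimes> (t \<otimes> a \<ominus> s \<otimes> b) = \<zero>" unfolding ab frac_rel_iff by blast
    from pq(2) obtain v where v: "c \<in> carrier R" "r \<in> S" "v \<in> S"
      "v \<otimes> (r \<otimes> b \<ominus> t \<otimes> c) = \<zero>" unfolding ab frac_rel_iff by blast
    have cc: "s \<in> carrier R" "t \<in> carrier R" "u \<in> carrier R" "v \<in> carrier R" "r \<in> carrier R"
      using u v S_in by auto
    have "(u \<otimes> v \<otimes> t) \<otimes> (r \<otimes> a \<ominus> s \<otimes> c) =
        (v \<otimes> r) \<otimes> (u \<otimes> (t \<otimes> a \<ominus> s \<otimes> b)) \<oplus> (u \<otimes> s) \<otimes> (v \<otimes> (r \<otimes> b \<ominus> t \<otimes> c))"
      using cc u(1,3) v(1) by algebra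
    also have "\<dots> = \<zero>" unfolding u(6) v(4) using cc by simp
    finally have "(u \<otimes> v \<otimes> t) \<otimes> (r \<otimes> a \<ominus> s \<otimes> c) = \<zero>" .
    moreover have "u \<otimes> v \<otimes> t \<in> S" using u v S_mult by simp
    ultimately show "(p, z) \<in> frac_rel R S" unfolding ab frac_rel_iff using u v by blast
  qed
qed

lemma frac_eq_iff:
  assumes "a \<in> carrier R" "s \<in> S" "b \<in> carrier R" "t \<in> S"
  shows "frac R S a s = frac R S b t \<longleftrightarrow> (\<exists>u\<in>S. u \<otimes> (t \<otimes> a \<ominus> s \<otimes> b) = \<zero>)"
  using eq_equiv_class_iff[OF equiv_frac_rel, of "(a, s)" "(b, t)"] assms
  by (simp add: frac_def frac_rel_iff)

lemma frac_eqI: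
  assumes "a \<in> carrier R" "s \<in> S" "b \<in> carrier R" "t \<in> S" "t \<otimes> a = s \<otimes> b"
  shows "frac R S a s = frac R S b t"
proof -
  have "\<one> \<otimes> (t \<otimes> a \<ominus> s \<otimes> b) = \<zero>" using assms S_in by (simp add: r_neg a_minus_def)
  then show ?thesis using frac_eq_iff assms S_one by blast
qed

lemma mem_frac:
  assumes "a \<in> carrier R" "s \<in> S"
  shows "(b, t) \<in> frac R S a s \<longleftrightarrow> b \<in> carrier R \<and> t \<in> S \<and> (\<exists>u\<in>S. u \<otimes> (t \<otimes> a \<ominus> s \<otimes> b) = \<zero>)"
  using assms by (simp add: frac_def frac_rel_iff)

lemma self_mem_frac:
  assumes "a \<in> carrier R" "s \<in> S"
  shows "(a, s) \<in> frac R S a s"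
  using equiv_class_self[OF equiv_frac_rel, of "(a, s)"] assms by (simp add: frac_def)

lemma carrier_L: "carrier L = {frac R S a s | a s. a \<in> carrier R \<and> s \<in> S}"
  by (auto simp: localization_def quotient_def frac_def)

lemma frac_closed: "a \<in> carrier R \<Longrightarrow> s \<in> S \<Longrightarrow> frac R S a s \<in> carrier L"
  by (auto simp: carrier_L)

lemma L_cases:
  assumes "x \<in> carrier L"
  obtains a s where "a \<in> carrier R" "s \<in> S" "x = frac R S a s"
  using assms by (auto simp: carrier_L)

text \<open>Evaluates the unions in the definition of sum and product of fractions.\<close>

lemma UN_frac_const:
  assumes "a \<in> carrier R" "s \<in> S" "b \<in> carrier R" "t \<in> S"
    and "\<And>a' s' b' t'. \<lbrakk>(a', s') \<in> frac R S a s; (b', t') \<in> frac R S b t\<rbrakk> \<Longrightarrow> f a' s' b' t' = z"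
  shows "(\<Union>(a', s') \<in> frac R S a s. \<Union>(b', t') \<in> frac R S b t. f a' s' b' t') = z"
proof -
  have *: "(\<Union>(b', t') \<in> frac R S b t. f a' s' b' t') = z" if "(a', s') \<in> frac R S a s" for a' s'
  proof -
    have "\<And>p. p \<in> frac R S b t \<Longrightarrow> (case p of (b', t') \<Rightarrow> f a' s' b' t') = z"
      using assms(5)[OF that] by auto
    then show ?thesis by (rule UN_const[OF self_mem_frac[OF assms(3,4)]])
  qed
  have "\<And>p. p \<in> frac R S a s \<Longrightarrow> (case p of (a', s') \<Rightarrow> \<Union>(b', t') \<in> frac R S b t. f a' s' b' t') = z"
    by (metis (no_types, lifting) * case_prod_conv surj_pair)
  then show ?thesis by (rule UN_const[OF self_mem_frac[OF assms(1,2)]])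
qed

lemma L_mult:
  assumes "a \<in> carrier R" "s \<in> S" "b \<in> carrier R" "t \<in> S"
  shows "frac R S a s \<otimes>\<^bsub>L\<^esub> frac R S b t = frac R S (a \<otimes> b) (s \<otimes> t)"
proof -
  have "frac R S (a' \<otimes> b') (s' \<otimes> t') = frac R S (a \<otimes> b) (s \<otimes> t)"
    if ab': "(a', s') \<in> frac R S a s" "(b', t') \<in> frac R S b t" for a' s' b' t'
  proof -
    from ab' obtain u v where u: "a' \<in> carrier R" "s' \<in> S" "b' \<in> carrier R" "t' \<in> S" "u \<in> S" "v \<in> S"
      "u \<otimes> (s' \<otimes> a \<ominus> s \<otimes> a') = \<zero>" "v \<otimes> (t' \<otimes> b \<ominus> t \<otimes> b') = \<zero>"
      using assms by (auto simp: mem_frac)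
    have c: "s \<in> carrier R" "t \<in> carrier R" "s' \<in> carrier R" "t' \<in> carrier R" "u \<in> carrier R" "v \<in> carrier R"
      using assms u S_in by auto
    have "(u \<otimes> v) \<otimes> ((s' \<otimes> t') \<otimes> (a \<otimes> b) \<ominus> (s \<otimes> t) \<otimes> (a' \<otimes> b')) =
       (v \<otimes> t' \<otimes> b) \<otimes> (u \<otimes> (s' \<otimes> a \<ominus> s \<otimes> a')) \<oplus> (u \<otimes> s \<otimes> a') \<otimes> (v \<otimes> (t' \<otimes> b \<ominus> t \<otimes> b'))"
      using c u(1,3) assms(1,3) by algebra
    also have "\<dots> = \<zero>" unfolding u(7,8) using c u(1,3) assms(1,3) by simp
    finally have "(u \<otimes> v) \<otimes> ((s' \<otimes> t') \<otimes> (a \<otimes> b) \<ominus> (s \<otimes> t) \<otimes> (a' \<otimes> b')) = \<zero>" .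
    moreover have "u \<otimes> v \<in> S" using u S_mult by simp
    ultimately have "frac R S (a \<otimes> b) (s \<otimes> t) = frac R S (a' \<otimes> b') (s' \<otimes> t')"
      using assms u S_mult by (subst frac_eq_iff) auto
    then show ?thesis by simp
  qed
  then have "(\<Union>(a', s') \<in> frac R S a s. \<Union>(b', t') \<in> frac R S b t. frac R S (a' \<otimes> b') (s' \<otimes> t'))
      = frac R S (a \<otimes> b) (s \<otimes> t)" by (rule UN_frac_const[OF assms])
  then show ?thesis by (simp add: localization_def)
qed

lemma L_add:
  assumes "a \<in> carrier R" "s \<in> S" "b \<in> carrier R" "t \<in> S"
  shows "frac R S a s \<oplus>\<^bsub>L\<^esub> frac R S b t = frac R S (t \<otimes> a \<oplus> s \<otimes> b) (s \<otimes> t)"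
proof -
  have "frac R S (t' \<otimes> a' \<oplus> s' \<otimes> b') (s' \<otimes> t') = frac R S (t \<otimes> a \<oplus> s \<otimes> b) (s \<otimes> t)"
    if ab': "(a', s') \<in> frac R S a s" "(b', t') \<in> frac R S b t" for a' s' b' t'
  proof -
    from ab' obtain u v where u: "a' \<in> carrier R" "s' \<in> S" "b' \<in> carrier R" "t' \<in> S" "u \<in> S" "v \<in> S"
      "u \<otimes> (s' \<otimes> a \<ominus> s \<otimes> a') = \<zero>" "v \<otimes> (t' \<otimes> b \<ominus> t \<otimes> b') = \<zero>"
      using assms by (auto simp: mem_frac)
    have c: "s \<in> carrier R" "t \<in> carrier R" "s' \<in> carrier R" "t' \<in> carrier R" "u \<in> carrier R" "v \<in> carrier R"
      using assms u S_in by auto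
    have "(u \<otimes> v) \<otimes> ((s' \<otimes> t') \<otimes> (t \<otimes> a \<oplus> s \<otimes> b) \<ominus> (s \<otimes> t) \<otimes> (t' \<otimes> a' \<oplus> s' \<otimes> b')) =
       (v \<otimes> t \<otimes> t') \<otimes> (u \<otimes> (s' \<otimes> a \<ominus> s \<otimes> a')) \<oplus> (u \<otimes> s \<otimes> s') \<otimes> (v \<otimes> (t' \<otimes> b \<ominus> t \<otimes> b'))"
      using c u(1,3) assms(1,3) by algebra
    also have "\<dots> = \<zero>" unfolding u(7,8) using c u(1,3) assms(1,3) by simp
    finally have "(u \<otimes> v) \<otimes> ((s' \<otimes> t') \<otimes> (t \<otimes> a \<oplus> s \<otimes> b) \<ominus> (s \<otimes> t) \<otimes> (t' \<otimes> a' \<oplus> s' \<otimes> b')) = \<zero>" .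
    moreover have "u \<otimes> v \<in> S" using u S_mult by simp
    ultimately have "frac R S (t \<otimes> a \<oplus> s \<otimes> b) (s \<otimes> t) = frac R S (t' \<otimes> a' \<oplus> s' \<otimes> b') (s' \<otimes> t')"
      using assms u c S_mult by (subst frac_eq_iff) auto
    then show ?thesis by simp
  qed
  then have "(\<Union>(a', s') \<in> frac R S a s. \<Union>(b', t') \<in> frac R S b t.
      frac R S (t' \<otimes> a' \<oplus> s' \<otimes> b') (s' \<otimes> t')) = frac R S (t \<otimes> a \<oplus> s \<otimes> b) (s \<otimes> t)"
    by (rule UN_frac_const[OF assms])
  then show ?thesis by (simp add: localization_def)
qed

lemma L_one: "\<one>\<^bsub>L\<^esub> = frac R S \<one> \<one>" and L_zero: "\<zero>\<^bsub>L\<^esub> = frac R S \<zero> \<one>"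
  by (simp_all add: localization_def)

lemma localization_cring: "cring L"
proof (rule cringI)
  show "abelian_group L"
  proof (rule abelian_groupI)
    fix x y assume "x \<in> carrier L" "y \<in> carrier L"
    then obtain a s b t where *: "a \<in> carrier R" "s \<in> S" "x = frac R S a s"
      "b \<in> carrier R" "t \<in> S" "y = frac R S b t" by (elim L_cases)
    then have c: "s \<in> carrier R" "t \<in> carrier R" using S_in by auto
    show "x \<oplus>\<^bsub>L\<^esub> y \<in> carrier L" using * c S_mult by (simp add: L_add frac_closed)
    show "x \<oplus>\<^bsub>L\<^esub> y = y \<oplus>\<^bsub>L\<^esub> x" using * c by (simp add: L_add a_comm m_comm)
    fix z assume "z \<in> carrier L"
    then obtain d r where z: "d \<in> carrier R" "r \<in> S" "z = frac R S d r" by (elim L_cases)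
    then have r: "r \<in> carrier R" using S_in by auto
    have "r \<otimes> (t \<otimes> a \<oplus> s \<otimes> b) \<oplus> (s \<otimes> t) \<otimes> d = (t \<otimes> r) \<otimes> a \<oplus> s \<otimes> (r \<otimes> b \<oplus> t \<otimes> d)"
      using *(1,4) z(1) c r by algebra
    then show "x \<oplus>\<^bsub>L\<^esub> y \<oplus>\<^bsub>L\<^esub> z = x \<oplus>\<^bsub>L\<^esub> (y \<oplus>\<^bsub>L\<^esub> z)"
      using * c z r S_mult by (simp add: L_add m_assoc)
  next
    show "\<zero>\<^bsub>L\<^esub> \<in> carrier L" by (simp add: L_zero frac_closed S_one)
  next
    fix x assume "x \<in> carrier L"
    then obtain a s where *: "a \<in> carrier R" "s \<in> S" "x = frac R S a s" by (elim L_cases)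
    then have c: "s \<in> carrier R" using S_in by auto
    show "\<zero>\<^bsub>L\<^esub> \<oplus>\<^bsub>L\<^esub> x = x" using * c by (simp add: L_zero L_add S_one)
    have "frac R S (\<ominus> a) s \<oplus>\<^bsub>L\<^esub> x = frac R S (s \<otimes> \<ominus> a \<oplus> s \<otimes> a) (s \<otimes> s)"
      using * by (simp add: L_add)
    also have "s \<otimes> \<ominus> a \<oplus> s \<otimes> a = \<zero>" using * c by algebra
    also have "frac R S \<zero> (s \<otimes> s) = \<zero>\<^bsub>L\<^esub>"
      unfolding L_zero by (rule frac_eqI) (use * c S_mult S_one in auto)
    finally show "\<exists>y\<in>carrier L. y \<oplus>\<^bsub>L\<^esub> x = \<zero>\<^bsub>L\<^esub>" using * frac_closed[of "\<ominus> a" s] by blast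
  qed
  show "comm_monoid L"
  proof (rule comm_monoidI)
    fix x y assume "x \<in> carrier L" "y \<in> carrier L"
    then obtain a s b t where *: "a \<in> carrier R" "s \<in> S" "x = frac R S a s"
      "b \<in> carrier R" "t \<in> S" "y = frac R S b t" by (elim L_cases)
    then have c: "s \<in> carrier R" "t \<in> carrier R" using S_in by auto
    show "x \<otimes>\<^bsub>L\<^esub> y \<in> carrier L" using * S_mult by (simp add: L_mult frac_closed)
    show "x \<otimes>\<^bsub>L\<^esub> y = y \<otimes>\<^bsub>L\<^esub> x" using * c by (simp add: L_mult m_comm)
    fix z assume "z \<in> carrier L"
    then obtain d r where z: "d \<in> carrier R" "r \<in> S" "z = frac R S d r" by (elim L_cases)
    then have r: "r \<in> carrier R" using S_in by auto
    show "x \<otimes>\<^bsub>L\<^esub> y \<otimes>\<^bsub>L\<^esub> z = x \<otimes>\<^bsub>L\<^esub> (y \<otimes>\<^bsub>L\<^esub> z)"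
      using * c z r S_mult by (simp add: L_mult m_assoc)
  next
    show "\<one>\<^bsub>L\<^esub> \<in> carrier L" by (simp add: L_one frac_closed S_one)
    fix x assume "x \<in> carrier L"
    then obtain a s where *: "a \<in> carrier R" "s \<in> S" "x = frac R S a s" by (elim L_cases)
    then show "\<one>\<^bsub>L\<^esub> \<otimes>\<^bsub>L\<^esub> x = x" using S_in by (simp add: L_one L_mult S_one)
  qed
next
  fix x y z assume "x \<in> carrier L" "y \<in> carrier L" "z \<in> carrier L"
  then obtain a s b t d r where *: "a \<in> carrier R" "s \<in> S" "x = frac R S a s"
      "b \<in> carrier R" "t \<in> S" "y = frac R S b t" 
      "d \<in> carrier R" "r \<in> S" "z = frac R S d r" by (elim L_cases)
  then have c: "s \<in> carrier R" "t \<in> carrier R" "r \<in> carrier R" using S_in by auto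
  have "(x \<oplus>\<^bsub>L\<^esub> y) \<otimes>\<^bsub>L\<^esub> z = frac R S ((t \<otimes> a \<oplus> s \<otimes> b) \<otimes> d) ((s \<otimes> t) \<otimes> r)"
    using * c S_mult by (simp add: L_add L_mult)
  also have "\<dots> = frac R S ((t \<otimes> r) \<otimes> (a \<otimes> d) \<oplus> (s \<otimes> r) \<otimes> (b \<otimes> d)) ((s \<otimes> r) \<otimes> (t \<otimes> r))"
  proof (rule frac_eqI)
    show "(s \<otimes> r) \<otimes> (t \<otimes> r) \<otimes> ((t \<otimes> a \<oplus> s \<otimes> b) \<otimes> d) =
      ((s \<otimes> t) \<otimes> r) \<otimes> ((t \<otimes> r) \<otimes> (a \<otimes> d) \<oplus> (s \<otimes> r) \<otimes> (b \<otimes> d))"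
      using *(1,4,7) c by algebra
  qed (use * c S_mult in auto)
  also have "\<dots> = x \<otimes>\<^bsub>L\<^esub> z \<oplus>\<^bsub>L\<^esub> y \<otimes>\<^bsub>L\<^esub> z"
    using * c S_mult by (simp add: L_add L_mult)
  finally show "(x \<oplus>\<^bsub>L\<^esub> y) \<otimes>\<^bsub>L\<^esub> z = x \<otimes>\<^bsub>L\<^esub> z \<oplus>\<^bsub>L\<^esub> y \<otimes>\<^bsub>L\<^esub> z" .
qed

sublocale L: cring L by (rule localization_cring)

lemma frac_zero_iff:
  assumes "a \<in> carrier R" "s \<in> S"
  shows "frac R S a s = \<zero>\<^bsub>L\<^esub> \<longleftrightarrow> (\<exists>u\<in>S. u \<otimes> a = \<zero>)"
proof -
  have "\<one> \<otimes> a \<ominus> s \<otimes> \<zero> = a" using assms S_in by (simp add: a_minus_def)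
  then show ?thesis unfolding L_zero using assms S_one by (simp add: frac_eq_iff)
qed

end

section \<open>Regular sequences and local depth\<close>

lemma (in ideal) coset_eq_iff:
  assumes "b \<in> carrier R"
  shows "I +> b = I \<longleftrightarrow> b \<in> I"
  using assms a_rcos_const rcos_const_imp_mem by auto

lemma (in ideal) nonzerodivisors_quot_iff:
  assumes x: "x \<in> carrier R"
  shows "I +> x \<in> nonzerodivisors (R Quot I) \<longleftrightarrow> (\<forall>b\<in>carrier R. x \<otimes> b \<in> I \<longrightarrow> b \<in> I)"
proof -
  have carr: "carrier (R Quot I) = {I +> b | b. b \<in> carrier R}"
    by (auto simp: FactRing_def A_RCOSETS_def' a_r_coset_def')
  have zero: "\<zero>\<^bsub>R Quot I\<^esub> = I" by (simp add: FactRing_def)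
  have mult: "(I +> x) \<otimes>\<^bsub>R Quot I\<^esub> (I +> b) = I +> (x \<otimes> b)" if "b \<in> carrier R" for b
    using that x rcoset_mult_add by (simp add: FactRing_def)
  have "I +> x \<in> nonzerodivisors (R Quot I) \<longleftrightarrow>
      (\<forall>b\<in>carrier R. (I +> x) \<otimes>\<^bsub>R Quot I\<^esub> (I +> b) = I \<longrightarrow> I +> b = I)"
    unfolding nonzerodivisors_def carr zero using x by blast
  also have "\<dots> \<longleftrightarrow> (\<forall>b\<in>carrier R. x \<otimes> b \<in> I \<longrightarrow> b \<in> I)"
    using mult coset_eq_iff x by (intro ball_cong) simp_all
  finally show ?thesis .
qed

lemma (in cring) genideal_empty: "Idl {} = {\<zero>}"
proof
  show "Idl {} \<subseteq> {\<zero>}" by (rule genideal_minimal[OF zeroideal]) simp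
  show "{\<zero>} \<subseteq> Idl {}" using ideal_zero[OF genideal_ideal[of "{}"]] by simp
qed

lemma (in cring) genideal_singleton:
  "a \<in> carrier R \<Longrightarrow> b \<in> Idl {a} \<longleftrightarrow> (\<exists>r\<in>carrier R. b = a \<otimes> r)"
  by (subst cgenideal_eq_genideal[symmetric]) (auto simp: cgenideal_def m_comm)

lemma (in cring) first_regular_iff:
  assumes "a \<in> carrier R"
  shows "Idl {} +> a \<in> nonzerodivisors (R Quot (Idl {})) \<longleftrightarrow> a \<in> nonzerodivisors R"
  using ideal.nonzerodivisors_quot_iff[OF genideal_ideal[of "{}"] assms] assms
  by (simp add: genideal_empty nonzerodivisors_def)

lemma (in cring) second_regular_iff:
  assumes "a \<in> carrier R" "b \<in> carrier R"
  shows "Idl {a} +> b \<in> nonzerodivisors (R Quot (Idl {a})) \<longleftrightarrow>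
    (\<forall>c\<in>carrier R. (\<exists>r\<in>carrier R. b \<otimes> c = a \<otimes> r) \<longrightarrow> (\<exists>r\<in>carrier R. c = a \<otimes> r))"
  using ideal.nonzerodivisors_quot_iff[OF genideal_ideal[of "{a}"] assms(2)] assms
  by (simp add: genideal_singleton)

lemma (in cring) genideal_in_proper:
  assumes "ideal M R" "M \<noteq> carrier R" "A \<subseteq> M"
  shows "Idl A \<noteq> carrier R"
  using genideal_minimal[OF assms(1,3)] assms(1,2)
  by (metis ideal.Icarr subsetI subset_antisym)

lemma (in cring) regular_sequence_1I:
  assumes "ideal M R" "M \<noteq> carrier R" "a \<in> M" "a \<in> nonzerodivisors R"
  shows "regular_sequence R [a]"
proof -
  have "a \<in> carrier R" using assms ideal_carrier by blast
  moreover have "genideal R {a} \<noteq> carrier R"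
    by (rule genideal_in_proper[OF assms(1,2)]) (use assms(3) in simp)
  ultimately show ?thesis
    using assms by (simp add: regular_sequence_def Let_def first_regular_iff)
qed

lemma (in cring) regular_sequence_2I:
  assumes "ideal M R" "M \<noteq> carrier R" "a \<in> M" "b \<in> M" "a \<in> nonzerodivisors R"
    and "\<And>c r. \<lbrakk>c \<in> carrier R; r \<in> carrier R; b \<otimes> c = a \<otimes> r\<rbrakk> \<Longrightarrow> \<exists>r\<in>carrier R. c = a \<otimes> r"
  shows "regular_sequence R [a, b]"
proof -
  have ab: "a \<in> carrier R" "b \<in> carrier R" using assms ideal_carrier by blast+
  moreover have "genideal R {a, b} \<noteq> carrier R"
    by (rule genideal_in_proper[OF assms(1,2)]) (use assms(3,4) in simp)
  moreover have "Idl {a} +> b \<in> nonzerodivisors (R Quot (Idl {a}))"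
    using second_regular_iff[OF ab] assms(6) by blast
  ultimately show ?thesis
    using assms(5) by (simp add: regular_sequence_def Let_def first_regular_iff less_Suc_eq)
qed

lemma (in cring) regular_sequence_2D:
  assumes "regular_sequence R xs" "2 \<le> length xs"
  shows "xs ! 0 \<in> nonzerodivisors R" "xs ! 1 \<in> carrier R"
    and "\<And>c r. \<lbrakk>c \<in> carrier R; r \<in> carrier R; (xs ! 1) \<otimes> c = (xs ! 0) \<otimes> r\<rbrakk>
          \<Longrightarrow> \<exists>r\<in>carrier R. c = (xs ! 0) \<otimes> r"
proof -
  obtain a b ys where xs: "xs = a # b # ys"
    using assms(2) by (metis Suc_le_length_iff numeral_2_eq_2)
  have ab: "a \<in> carrier R" "b \<in> carrier R" using assms(1) by (auto simp: regular_sequence_def xs)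
  have *: "Idl (set (take i xs)) +> (xs ! i) \<in> nonzerodivisors (R Quot (Idl (set (take i xs))))"
    if "i < length xs" for i using assms(1) that unfolding regular_sequence_def Let_def by blast
  have 0: "a \<in> nonzerodivisors R" using *[of 0] first_regular_iff[OF ab(1)] by (simp add: xs)
  have 1: "\<And>c r. \<lbrakk>c \<in> carrier R; r \<in> carrier R; b \<otimes> c = a \<otimes> r\<rbrakk> \<Longrightarrow> \<exists>r\<in>carrier R. c = a \<otimes> r"
    using *[of 1] second_regular_iff[OF ab] by (auto simp: xs)
  show "xs ! 0 \<in> nonzerodivisors R" "xs ! 1 \<in> carrier R" using 0 ab by (simp_all add: xs)
  show "\<And>c r. \<lbrakk>c \<in> carrier R; r \<in> carrier R; (xs ! 1) \<otimes> c = (xs ! 0) \<otimes> r\<rbrakk>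
          \<Longrightarrow> \<exists>r\<in>carrier R. c = (xs ! 0) \<otimes> r" using 1 by (simp add: xs)
qed

lemma local_depth_ge_iff:
  assumes "0 < k"
  shows "enat k \<le> local_depth A \<longleftrightarrow>
    (\<exists>xs. regular_sequence A xs \<and> set xs \<subseteq> (THE M. maximalideal M A) \<and> k \<le> length xs)"
    (is "?l \<longleftrightarrow> ?r")
proof
  assume ?r
  then obtain xs where xs: "regular_sequence A xs" "set xs \<subseteq> (THE M. maximalideal M A)" "k \<le> length xs"
    by blast
  then have "enat (length xs) \<le> local_depth A" unfolding local_depth_def by (intro SUP_upper) simp
  then show ?l using xs(3) by (meson enat_ord_simps(1) order_trans)
next
  assume l: ?l
  show ?r
  proof (rule ccontr)
    assume no: "\<not> ?r"
    have "local_depth A \<le> enat (k - 1)"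
      unfolding local_depth_def
    proof (rule SUP_least)
      fix xs assume "xs \<in> {xs. regular_sequence A xs \<and> set xs \<subseteq> (THE M. maximalideal M A)}"
      then have "\<not> k \<le> length xs" using no by blast
      then show "enat (length xs) \<le> enat (k - 1)" by simp
    qed
    then have "enat k \<le> enat (k - 1)" using l order_trans by blast
    then show False using assms by simp
  qed
qed

section \<open>Depth of a localization\<close>

locale localization_at_prime = cring R + prime: primeideal P R for P and R (structure)

sublocale localization_at_prime \<subseteq> mult_submonoid R "carrier R - P"
proof
  show "\<one> \<in> carrier R - P" using prime.I_notcarr prime.one_imp_carrier by auto
  show "s \<otimes> t \<in> carrier R - P" if "s \<in> carrier R - P" "t \<in> carrier R - P" for s t
    using that prime.I_prime[of s t] by auto
qed auto

context localization_at_prime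
begin

definition "max_ideal = {frac R (carrier R - P) a s | a s. a \<in> P \<and> s \<in> carrier R - P}"

lemma frac_in_max_ideal_iff:
  assumes "a \<in> carrier R" "s \<in> carrier R - P"
  shows "frac R (carrier R - P) a s \<in> max_ideal \<longleftrightarrow> a \<in> P"
proof
  assume "frac R (carrier R - P) a s \<in> max_ideal"
  then obtain b t where b: "b \<in> P" "t \<in> carrier R - P"
    "frac R (carrier R - P) a s = frac R (carrier R - P) b t" unfolding max_ideal_def by blast
  have bR: "b \<in> carrier R" using b by auto
  obtain u where u: "u \<in> carrier R - P" "u \<otimes> (t \<otimes> a \<ominus> s \<otimes> b) = \<zero>"
    using b(3) frac_eq_iff[OF assms bR b(2)] by blast
  have c: "u \<in> carrier R" "t \<in> carrier R" "s \<in> carrier R" using u b assms by auto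
  have "(u \<otimes> t) \<otimes> a = u \<otimes> (t \<otimes> a \<ominus> s \<otimes> b) \<oplus> (u \<otimes> s) \<otimes> b"
    using c bR assms(1) by algebra
  also have "\<dots> = (u \<otimes> s) \<otimes> b" unfolding u(2) using c bR by simp
  also have "\<dots> \<in> P" by (rule prime.I_l_closed) (use b(1) c in simp_all)
  finally have "u \<otimes> t \<in> P \<or> a \<in> P" by (intro prime.I_prime) (use c assms(1) in simp_all)
  then show "a \<in> P" using S_mult[OF u(1) b(2)] by simp
next
  assume "a \<in> P"
  then show "frac R (carrier R - P) a s \<in> max_ideal" using assms(2) unfolding max_ideal_def by blast
qed

lemma outside_max_ideal_unit:
  assumes J: "ideal J L" and x: "x \<in> J" "x \<notin> max_ideal"
  shows "J = carrier L"
proof -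
  interpret J: ideal J L by fact
  have "x \<in> carrier L" using x(1) by (rule J.Icarr)
  then obtain a s where a: "a \<in> carrier R" "s \<in> carrier R - P" "x = frac R (carrier R - P) a s"
    by (elim L_cases)
  have aS: "a \<in> carrier R - P" using x(2) frac_in_max_ideal_iff[OF a(1,2)] a by simp
  have "x \<otimes>\<^bsub>L\<^esub> frac R (carrier R - P) s a = frac R (carrier R - P) (a \<otimes> s) (s \<otimes> a)"
    using a aS by (simp add: L_mult)
  also have "\<dots> = \<one>\<^bsub>L\<^esub>" unfolding L_one
    by (rule frac_eqI) (use a(1,2) aS S_mult S_one in \<open>simp_all add: m_comm\<close>)
  finally have "\<one>\<^bsub>L\<^esub> \<in> J" using J.I_r_closed[OF x(1) frac_closed[of s a]] a(2) aS by simp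
  then show ?thesis by (rule J.one_imp_carrier)
qed

lemma max_ideal_ideal: "ideal max_ideal L"
proof (rule L.idealI_cring)
  show "max_ideal \<subseteq> carrier L" using frac_closed unfolding max_ideal_def by auto
  show "\<zero>\<^bsub>L\<^esub> \<in> max_ideal"
    unfolding L_zero using frac_in_max_ideal_iff[of \<zero> \<one>] S_one ideal_zero[OF prime.is_ideal] by simp
  fix x y assume x: "x \<in> max_ideal" 
  then obtain a s where a: "a \<in> P" "s \<in> carrier R - P" "x = frac R (carrier R - P) a s"
    unfolding max_ideal_def by blast
  have c: "a \<in> carrier R" "s \<in> carrier R" using a by auto
  { assume "y \<in> max_ideal"
    then obtain b t where b: "b \<in> P" "t \<in> carrier R - P" "y = frac R (carrier R - P) b t"
      unfolding max_ideal_def by blast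
    have d: "b \<in> carrier R" "t \<in> carrier R" using b by auto
    have "t \<otimes> a \<oplus> s \<otimes> b \<in> P"
      using ideal_add[OF prime.is_ideal prime.I_l_closed[OF a(1) d(2)] prime.I_l_closed[OF b(1) c(2)]] .
    then show "x \<oplus>\<^bsub>L\<^esub> y \<in> max_ideal"
      unfolding a(3) b(3) L_add[OF c(1) a(2) d(1) b(2)] max_ideal_def using S_mult[OF a(2) b(2)] by blast
  }
  { assume "y \<in> carrier L"
    then obtain b t where b: "b \<in> carrier R" "t \<in> carrier R - P" "y = frac R (carrier R - P) b t"
      by (elim L_cases)
    have "b \<otimes> a \<in> P" using prime.I_l_closed[OF a(1) b(1)] .
    then show "y \<otimes>\<^bsub>L\<^esub> x \<in> max_ideal"
      unfolding a(3) b(3) L_mult[OF b(1,2) c(1) a(2)] max_ideal_def using S_mult[OF b(2) a(2)] by blast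
  }
qed

lemma one_notin_max_ideal: "\<one>\<^bsub>L\<^esub> \<notin> max_ideal"
  unfolding L_one using frac_in_max_ideal_iff[of \<one> \<one>] S_one by simp

lemma max_ideal_proper: "max_ideal \<noteq> carrier L"
  using one_notin_max_ideal L.one_closed by metis

lemma max_ideal_maximal: "maximalideal max_ideal L"
proof (rule maximalidealI[OF max_ideal_ideal])
  show "carrier L \<noteq> max_ideal" using max_ideal_proper by simp
  fix J assume J: "ideal J L" "max_ideal \<subseteq> J" "J \<subseteq> carrier L"
  show "J = max_ideal \<or> J = carrier L" using outside_max_ideal_unit[OF J(1)] J(2) by blast
qed

lemma the_maximal_ideal: "(THE M. maximalideal M L) = max_ideal"
proof (rule the_equality[where P = "\<lambda>M. maximalideal M L", OF max_ideal_maximal])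
  fix M assume M: "maximalideal M L"
  interpret M: maximalideal M L by fact
  have "M \<subseteq> max_ideal" using outside_max_ideal_unit[OF M.is_ideal] M.I_notcarr by blast
  moreover have "max_ideal \<subseteq> carrier L" using max_ideal_ideal L.ideal_carrier by blast
  ultimately have "max_ideal = M \<or> max_ideal = carrier L"
    using M.I_maximal[OF max_ideal_ideal] by blast
  then show "M = max_ideal" using max_ideal_proper by simp
qed

lemma frac_nonzerodivisor:
  assumes x: "x \<in> nonzerodivisors R" "x \<in> carrier R"
  shows "frac R (carrier R - P) x \<one> \<in> nonzerodivisors L"
proof -
  have "c = \<zero>\<^bsub>L\<^esub>" if c: "c \<in> carrier L" "frac R (carrier R - P) x \<one> \<otimes>\<^bsub>L\<^esub> c = \<zero>\<^bsub>L\<^esub>" for c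
  proof -
    obtain a s where a: "a \<in> carrier R" "s \<in> carrier R - P" "c = frac R (carrier R - P) a s"
      using c(1) by (elim L_cases)
    have "frac R (carrier R - P) (x \<otimes> a) s = \<zero>\<^bsub>L\<^esub>" using c(2) a x S_one by (simp add: L_mult)
    then obtain u where u: "u \<in> carrier R - P" "u \<otimes> (x \<otimes> a) = \<zero>"
      using frac_zero_iff[of "x \<otimes> a" s] a x by auto
    have "x \<otimes> (u \<otimes> a) = \<zero>" using u x a by (simp add: m_lcomm)
    then have "u \<otimes> a = \<zero>" using x(1) u a unfolding nonzerodivisors_def by simp
    then show ?thesis using frac_zero_iff[OF a(1,2)] u a(3) by blast
  qed
  then show ?thesis using frac_closed[OF x(2) S_one] unfolding nonzerodivisors_def by blast
qed

lemma depth_ge_iff: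
  "0 < k \<Longrightarrow> enat k \<le> local_depth (localization_at R P) \<longleftrightarrow>
    (\<exists>xs. regular_sequence L xs \<and> set xs \<subseteq> max_ideal \<and> k \<le> length xs)"
  unfolding localization_at_def by (simp add: local_depth_ge_iff the_maximal_ideal)

lemma depth_ge_1:
  assumes "x \<in> P" "x \<in> nonzerodivisors R"
  shows "enat 1 \<le> local_depth (localization_at R P)"
proof -
  have x: "x \<in> carrier R" "frac R (carrier R - P) x \<one> \<in> max_ideal"
    using assms frac_in_max_ideal_iff[of x \<one>] S_one by auto
  then have "regular_sequence L [frac R (carrier R - P) x \<one>]"
    using L.regular_sequence_1I[OF max_ideal_ideal max_ideal_proper] frac_nonzerodivisor assms(2) by blast
  moreover have "set [frac R (carrier R - P) x \<one>] \<subseteq> max_ideal" using x(2) by simp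
  moreover have "1 \<le> length [frac R (carrier R - P) x \<one>]" by simp
  ultimately show ?thesis unfolding depth_ge_iff[OF zero_less_one] by blast
qed

text \<open>If \<open>P\<close> annihilates the class of \<open>y\<close> modulo \<open>x\<close>, then for every nonzerodivisor \<open>a\<close> in the maximal
  ideal it annihilates the class of \<open>y' = a y / x\<close> modulo \<open>a\<close>, and that class is still nonzero. So
  no second element of the maximal ideal is regular modulo \<open>a\<close>.\<close>

lemma denominator_ideal_depth:
  assumes "denominator_ideal R P"
  shows "\<not> enat 2 \<le> local_depth (localization_at R P)"
proof
  assume "enat 2 \<le> local_depth (localization_at R P)"
  then obtain xs where xs: "regular_sequence L xs" "set xs \<subseteq> max_ideal" "2 \<le> length xs"
    unfolding depth_ge_iff[OF zero_less_numeral] by blast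
  obtain x y where x: "x \<in> nonzerodivisors R" and y: "y \<in> carrier R"
    and "P = {r \<in> carrier R. \<exists>z \<in> carrier R. r \<otimes> y = x \<otimes> z}"
    using assms unfolding denominator_ideal_def by blast
  then have P: "r \<in> P \<longleftrightarrow> r \<in> carrier R \<and> (\<exists>z \<in> carrier R. r \<otimes> y = x \<otimes> z)" for r by blast
  have xR: "x \<in> carrier R" using x by (simp add: nonzerodivisors_def)
  note reg = L.regular_sequence_2D[OF xs(1,3)]
  have "xs ! 0 \<in> set xs" "xs ! 1 \<in> set xs" using xs(3) by (auto intro: nth_mem)
  then have "xs ! 0 \<in> max_ideal" "xs ! 1 \<in> max_ideal" using xs(2) by auto
  then obtain a s b t where a: "a \<in> P" "s \<in> carrier R - P" "xs ! 0 = frac R (carrier R - P) a s"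
    and b: "b \<in> P" "t \<in> carrier R - P" "xs ! 1 = frac R (carrier R - P) b t"
    unfolding max_ideal_def by blast
  have c: "a \<in> carrier R" "s \<in> carrier R" "b \<in> carrier R" "t \<in> carrier R" using a b by auto
  obtain y' where y': "y' \<in> carrier R" "a \<otimes> y = x \<otimes> y'" using a(1) P by blast
  obtain z where z: "z \<in> carrier R" "b \<otimes> y = x \<otimes> z" using b(1) P by blast
  have "x \<otimes> (b \<otimes> y') = b \<otimes> (x \<otimes> y')" using c xR y'(1) by algebra
  also have "\<dots> = a \<otimes> (b \<otimes> y)" unfolding y'(2)[symmetric] using c y by algebra
  also have "\<dots> = x \<otimes> (a \<otimes> z)" unfolding z(2) using c xR z(1) by algebra
  finally have "x \<otimes> (b \<otimes> y') = x \<otimes> (a \<otimes> z)" .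
  then have by': "b \<otimes> y' = a \<otimes> z"
    by (rule nonzerodivisors_cancel[OF x, rotated 2]) (use c y'(1) z(1) in simp_all)
  have "(xs ! 1) \<otimes>\<^bsub>L\<^esub> frac R (carrier R - P) y' \<one> = (xs ! 0) \<otimes>\<^bsub>L\<^esub> frac R (carrier R - P) (s \<otimes> z) t"
  proof -
    have "frac R (carrier R - P) (b \<otimes> y') t = frac R (carrier R - P) (a \<otimes> (s \<otimes> z)) (s \<otimes> t)"
    proof (rule frac_eqI)
      show "s \<otimes> t \<otimes> (b \<otimes> y') = t \<otimes> (a \<otimes> (s \<otimes> z))" unfolding by' using c z(1) by algebra
    qed (use c a(2) b(2) y'(1) z(1) S_mult in simp_all)
    then show ?thesis using a b c y'(1) z(1) S_one by (simp add: L_mult)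
  qed
  moreover have "frac R (carrier R - P) y' \<one> \<in> carrier L" using y'(1) S_one by (simp add: frac_closed)
  moreover have "frac R (carrier R - P) (s \<otimes> z) t \<in> carrier L"
    using c z(1) b(2) by (simp add: frac_closed)
  ultimately obtain r where r: "r \<in> carrier L" "frac R (carrier R - P) y' \<one> = (xs ! 0) \<otimes>\<^bsub>L\<^esub> r"
    using reg(3) by blast
  obtain r0 q where r0: "r0 \<in> carrier R" "q \<in> carrier R - P" "r = frac R (carrier R - P) r0 q"
    using r(1) by (elim L_cases)
  have q: "q \<in> carrier R" using r0 by simp
  have "frac R (carrier R - P) y' \<one> = frac R (carrier R - P) (a \<otimes> r0) (s \<otimes> q)"
    using r(2) a c r0 by (simp add: L_mult)
  then obtain u where u: "u \<in> carrier R - P" "u \<otimes> ((s \<otimes> q) \<otimes> y' \<ominus> \<one> \<otimes> (a \<otimes> r0)) = \<zero>"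
    using frac_eq_iff[OF y'(1) S_one, of "a \<otimes> r0" "s \<otimes> q"] c r0 a S_mult by auto
  have uR: "u \<in> carrier R" using u by simp
  define g where "g = u \<otimes> s \<otimes> q \<otimes> y \<ominus> x \<otimes> (u \<otimes> r0)"
  have gR: "g \<in> carrier R" using uR c q y xR r0 by (simp add: g_def)
  have "a \<otimes> g = (u \<otimes> s \<otimes> q) \<otimes> (a \<otimes> y) \<ominus> x \<otimes> (u \<otimes> (a \<otimes> r0))"
    unfolding g_def using uR c q y xR r0(1) by algebra
  also have "\<dots> = x \<otimes> (u \<otimes> ((s \<otimes> q) \<otimes> y' \<ominus> \<one> \<otimes> (a \<otimes> r0)))"
    unfolding y'(2) using uR c q y'(1) xR r0(1) by algebra
  finally have "a \<otimes> g = \<zero>" using u(2) xR by simp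
  then have "(xs ! 0) \<otimes>\<^bsub>L\<^esub> frac R (carrier R - P) g \<one> = \<zero>\<^bsub>L\<^esub>"
    using a c gR S_one by (simp add: L_mult frac_zero_iff) (metis Diff_iff r_null)
  then have "frac R (carrier R - P) g \<one> = \<zero>\<^bsub>L\<^esub>"
    using reg(1) frac_closed[OF gR S_one] unfolding nonzerodivisors_def by blast
  then obtain v where v: "v \<in> carrier R - P" "v \<otimes> g = \<zero>" using frac_zero_iff[OF gR S_one] by blast
  have vR: "v \<in> carrier R" using v by simp
  have "(v \<otimes> (u \<otimes> (s \<otimes> q))) \<otimes> y = v \<otimes> g \<oplus> x \<otimes> (v \<otimes> (u \<otimes> r0))"
    unfolding g_def using vR uR c q y xR r0(1) by algebra
  also have "\<dots> = x \<otimes> (v \<otimes> (u \<otimes> r0))" unfolding v(2) using xR vR uR r0(1) by simp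
  finally have "v \<otimes> (u \<otimes> (s \<otimes> q)) \<in> P"
    unfolding P using vR uR c q r0(1) by blast
  then show False using S_mult[OF v(1) S_mult[OF u(1) S_mult[OF a(2) r0(2)]]] by simp
qed

end

text \<open>Conversely, if \<open>P\<close> is not the annihilator of an element of \<open>R/xR\<close>, then not all of \<open>P\<close> can be
  zero divisors on the localization of \<open>R/xR\<close> at \<open>P\<close>; an exception \<open>b\<close> extends \<open>x\<close> to a regular
  sequence.\<close>

lemma (in noetherian_cring) depth_ge_2:
  assumes P: "primeideal P R" and x: "x \<in> P" "x \<in> nonzerodivisors R"
    and no: "\<not> denominator_ideal R P"
  shows "enat 2 \<le> local_depth (localization_at R P)"
proof -
  interpret localization_at_prime P R using P is_cring by (simp add: localization_at_prime_def)
  have xR: "x \<in> carrier R" using x by auto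
  define J where "J = Idl {x}"
  have J: "ideal J R" unfolding J_def by (rule genideal_ideal) (use xR in simp)
  have J_iff: "v \<in> J \<longleftrightarrow> (\<exists>z\<in>carrier R. v = x \<otimes> z)" for v
    unfolding J_def by (rule genideal_singleton[OF xR])
  have "\<exists>b\<in>P. \<forall>y\<in>carrier R. b \<in> colon R J y \<longrightarrow> colon R J y \<inter> (carrier R - P) \<noteq> {}"
  proof (rule ccontr)
    assume "\<not> ?thesis"
    then have zd: "\<exists>y\<in>carrier R. b \<in> colon R J y \<and> colon R J y \<inter> (carrier R - P) = {}" if "b \<in> P" for b
      using that by blast
    have "\<exists>y \<in> carrier R. P \<subseteq> colon R J y \<and> colon R J y \<inter> (carrier R - P) = {}"
      by (rule common_zerodivisor_witness[OF J prime.is_ideal S_carrier S_one S_mult zd])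
    then obtain y where y: "y \<in> carrier R" "P \<subseteq> colon R J y" "colon R J y \<inter> (carrier R - P) = {}"
      by blast
    have "colon R J y \<subseteq> carrier R" by (auto simp: colon_def)
    then have "P = colon R J y" using y by blast
    then have "P = {r \<in> carrier R. \<exists>z \<in> carrier R. r \<otimes> y = x \<otimes> z}" unfolding colon_def J_iff .
    then show False using no x(2) y(1) unfolding denominator_ideal_def by blast
  qed
  then obtain b where b: "b \<in> P"
    "\<And>y. \<lbrakk>y \<in> carrier R; b \<in> colon R J y\<rbrakk> \<Longrightarrow> colon R J y \<inter> (carrier R - P) \<noteq> {}" by blast
  have bR: "b \<in> carrier R" using b by auto
  have mem: "frac R (carrier R - P) x \<one> \<in> max_ideal" "frac R (carrier R - P) b \<one> \<in> max_ideal"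
    using x b frac_in_max_ideal_iff[of _ \<one>] S_one xR bR by auto
  have "regular_sequence L [frac R (carrier R - P) x \<one>, frac R (carrier R - P) b \<one>]"
  proof (rule L.regular_sequence_2I[OF max_ideal_ideal max_ideal_proper mem frac_nonzerodivisor[OF x(2) xR]])
    fix c r assume cr: "c \<in> carrier L" "r \<in> carrier L"
      "frac R (carrier R - P) b \<one> \<otimes>\<^bsub>L\<^esub> c = frac R (carrier R - P) x \<one> \<otimes>\<^bsub>L\<^esub> r"
    obtain c0 s where c0: "c0 \<in> carrier R" "s \<in> carrier R - P" "c = frac R (carrier R - P) c0 s"
      using cr(1) by (elim L_cases)
    obtain r0 t where r0: "r0 \<in> carrier R" "t \<in> carrier R - P" "r = frac R (carrier R - P) r0 t"
      using cr(2) by (elim L_cases)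
    have st: "s \<in> carrier R" "t \<in> carrier R" using c0 r0 by auto
    have "frac R (carrier R - P) (b \<otimes> c0) s = frac R (carrier R - P) (x \<otimes> r0) t"
      using cr(3) c0 r0 bR xR S_one by (simp add: L_mult)
    then obtain u where u: "u \<in> carrier R - P" "u \<otimes> (t \<otimes> (b \<otimes> c0) \<ominus> s \<otimes> (x \<otimes> r0)) = \<zero>"
      using frac_eq_iff[of "b \<otimes> c0" s "x \<otimes> r0" t] c0 r0 bR xR by auto
    have uR: "u \<in> carrier R" using u by simp
    have "b \<otimes> (u \<otimes> (t \<otimes> c0)) = u \<otimes> (t \<otimes> (b \<otimes> c0) \<ominus> s \<otimes> (x \<otimes> r0)) \<oplus> x \<otimes> (u \<otimes> (s \<otimes> r0))"
      using bR uR st c0(1) r0(1) xR by algebra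
    also have "\<dots> = x \<otimes> (u \<otimes> (s \<otimes> r0))" unfolding u(2) using uR st r0(1) xR by simp
    finally have "b \<in> colon R J (u \<otimes> (t \<otimes> c0))"
      unfolding colon_def J_iff using bR uR st r0(1) by blast
    moreover have yR: "u \<otimes> (t \<otimes> c0) \<in> carrier R" using uR st c0(1) by simp
    ultimately obtain v where v: "v \<in> carrier R - P" "v \<in> colon R J (u \<otimes> (t \<otimes> c0))" using b(2) by blast
    then obtain z where z: "z \<in> carrier R" "v \<otimes> (u \<otimes> (t \<otimes> c0)) = x \<otimes> z"
      unfolding colon_def J_iff by blast
    have vR: "v \<in> carrier R" using v by simp
    have den: "v \<otimes> (u \<otimes> t) \<otimes> s \<in> carrier R - P"
      using S_mult[OF S_mult[OF v(1) S_mult[OF u(1) r0(2)]] c0(2)] .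
    have "c = frac R (carrier R - P) (x \<otimes> z) (v \<otimes> (u \<otimes> t) \<otimes> s)"
      unfolding c0(3)
    proof (rule frac_eqI[OF c0(1,2) _ den])
      show "v \<otimes> (u \<otimes> t) \<otimes> s \<otimes> c0 = s \<otimes> (x \<otimes> z)"
        unfolding z(2)[symmetric] using vR uR st c0(1) by algebra
    qed (use xR z in simp)
    also have "\<dots> = frac R (carrier R - P) x \<one> \<otimes>\<^bsub>L\<^esub> frac R (carrier R - P) z (v \<otimes> (u \<otimes> t) \<otimes> s)"
      using L_mult[OF xR S_one z(1) den] den by simp
    finally show "\<exists>r\<in>carrier L. c = frac R (carrier R - P) x \<one> \<otimes>\<^bsub>L\<^esub> r"
      using frac_closed[OF z(1) den] by blast
  qed
  moreover have "set [frac R (carrier R - P) x \<one>, frac R (carrier R - P) b \<one>] \<subseteq> max_ideal"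
    using mem by simp
  moreover have "2 \<le> length [frac R (carrier R - P) x \<one>, frac R (carrier R - P) b \<one>]" by simp
  ultimately show ?thesis unfolding depth_ge_iff[OF zero_less_numeral] by blast
qed

section \<open>Reflexive prime ideals\<close>

lemma ideal_module_simps:
  "carrier (ideal_module R I) = I"
  "add (ideal_module R I) = add R"
  "smult (ideal_module R I) = monoid.mult R"
  "carrier (regular_module R) = carrier R"
  "add (regular_module R) = add R"
  "smult (regular_module R) = monoid.mult R"
  by (simp_all add: ideal_module_def regular_module_def)

lemma dual_module_simps:
  "carrier (dual_module R M) = module_hom R M (regular_module R)"
  "f \<oplus>\<^bsub>dual_module R M\<^esub> g = (\<lambda>x \<in> carrier M. f x \<oplus>\<^bsub>R\<^esub> g x)"
  "r \<odot>\<^bsub>dual_module R M\<^esub> f = (\<lambda>x \<in> carrier M. r \<otimes>\<^bsub>R\<^esub> f x)"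
  by (simp_all add: dual_module_def hom_module_def ideal_module_simps)

locale ideal_dual = cring R + ideal: ideal I R for I and R (structure)
begin

abbreviation "dual \<equiv> carrier (dual_module R (ideal_module R I))"
abbreviation "bidual \<equiv> carrier (dual_module R (dual_module R (ideal_module R I)))"

lemma dual_iff:
  "f \<in> dual \<longleftrightarrow> f \<in> I \<rightarrow>\<^sub>E carrier R \<and> (\<forall>x\<in>I. \<forall>y\<in>I. f (x \<oplus> y) = f x \<oplus> f y) \<and>
     (\<forall>r\<in>carrier R. \<forall>x\<in>I. f (r \<otimes> x) = r \<otimes> f x)"
  by (simp add: dual_module_simps module_hom_def ideal_module_simps)

lemma dualI:
  assumes "\<And>x. x \<in> I \<Longrightarrow> f x \<in> carrier R" "\<And>x y. \<lbrakk>x \<in> I; y \<in> I\<rbrakk> \<Longrightarrow> f (x \<oplus> y) = f x \<oplus> f y"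
    and "\<And>r x. \<lbrakk>r \<in> carrier R; x \<in> I\<rbrakk> \<Longrightarrow> f (r \<otimes> x) = r \<otimes> f x"
  shows "(\<lambda>x\<in>I. f x) \<in> dual"
  unfolding dual_iff
  using assms ideal_add[OF ideal.is_ideal] ideal.I_l_closed by simp

lemma dualD:
  assumes "f \<in> dual"
  shows "x \<in> I \<Longrightarrow> f x \<in> carrier R"
    and "\<lbrakk>x \<in> I; y \<in> I\<rbrakk> \<Longrightarrow> f (x \<oplus> y) = f x \<oplus> f y"
    and "\<lbrakk>r \<in> carrier R; x \<in> I\<rbrakk> \<Longrightarrow> f (r \<otimes> x) = r \<otimes> f x"
  using assms unfolding dual_iff by auto

lemma dual_add_closed: "\<lbrakk>f \<in> dual; g \<in> dual\<rbrakk> \<Longrightarrow> (\<lambda>x\<in>I. f x \<oplus> g x) \<in> dual"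
  by (rule dualI) (simp_all add: dualD r_distr a_ac ideal.Icarr)

lemma dual_smult_closed: "\<lbrakk>f \<in> dual; r \<in> carrier R\<rbrakk> \<Longrightarrow> (\<lambda>x\<in>I. r \<otimes> f x) \<in> dual"
  by (rule dualI) (simp_all add: dualD r_distr m_ac ideal.Icarr)

lemma inclusion_dual: "(\<lambda>x\<in>I. x) \<in> dual"
  by (rule dualI) (simp_all add: ideal.Icarr)

text \<open>Both sides are \<open>f (x y)\<close>. When \<open>x\<close> is a nonzerodivisor this says that \<open>f\<close> is multiplication by
  the fraction \<open>f x / x\<close>, which identifies the dual with a set of fractions.\<close>

lemma dual_swap:
  assumes "f \<in> dual" "x \<in> I" "y \<in> I"
  shows "x \<otimes> f y = y \<otimes> f x"
proof -
  have c: "x \<in> carrier R" "y \<in> carrier R" using assms by (simp_all add: ideal.Icarr)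
  have "x \<otimes> f y = f (x \<otimes> y)" using dualD(3)[OF assms(1) c(1) assms(3)] by simp
  also have "\<dots> = f (y \<otimes> x)" using c by (simp add: m_comm)
  finally show ?thesis using dualD(3)[OF assms(1) c(2) assms(2)] by simp
qed

lemma bidual_iff:
  "\<Phi> \<in> bidual \<longleftrightarrow> \<Phi> \<in> dual \<rightarrow>\<^sub>E carrier R \<and>
     (\<forall>f\<in>dual. \<forall>g\<in>dual. \<Phi> (\<lambda>x\<in>I. f x \<oplus> g x) = \<Phi> f \<oplus> \<Phi> g) \<and>
     (\<forall>r\<in>carrier R. \<forall>f\<in>dual. \<Phi> (\<lambda>x\<in>I. r \<otimes> f x) = r \<otimes> \<Phi> f)"
  by (subst dual_module_simps(1)) (simp add: module_hom_def dual_module_simps(2,3) ideal_module_simps)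

lemma bidual_map_eq: "bidual_map R (ideal_module R I) = (\<lambda>x\<in>I. \<lambda>f\<in>dual. f x)"
  by (simp add: bidual_map_def ideal_module_simps)

lemma evaluation_bidual: "x \<in> I \<Longrightarrow> (\<lambda>f\<in>dual. f x) \<in> bidual"
  unfolding bidual_iff using dual_add_closed dual_smult_closed dualD(1) by simp

lemma bidual_map_hom:
  "bidual_map R (ideal_module R I) \<in>
     module_hom R (ideal_module R I) (dual_module R (dual_module R (ideal_module R I)))"
  unfolding bidual_map_eq module_hom_def ideal_module_simps
proof (intro CollectI conjI ballI)
  show "(\<lambda>x\<in>I. \<lambda>f\<in>dual. f x) \<in> I \<rightarrow>\<^sub>E bidual" using evaluation_bidual by simp
  show "(\<lambda>x\<in>I. \<lambda>f\<in>dual. f x) (x \<oplus> y) =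
      (\<lambda>x\<in>I. \<lambda>f\<in>dual. f x) x \<oplus>\<^bsub>dual_module R (dual_module R (ideal_module R I))\<^esub> (\<lambda>x\<in>I. \<lambda>f\<in>dual. f x) y"
    if "x \<in> I" "y \<in> I" for x y
    unfolding dual_module_simps(2)
    using that ideal_add[OF ideal.is_ideal that] by (auto simp: dualD(2) intro!: restrict_ext)
  show "(\<lambda>x\<in>I. \<lambda>f\<in>dual. f x) (r \<otimes> x) =
      r \<odot>\<^bsub>dual_module R (dual_module R (ideal_module R I))\<^esub> (\<lambda>x\<in>I. \<lambda>f\<in>dual. f x) x"
    if "r \<in> carrier R" "x \<in> I" for r x
    unfolding dual_module_simps(3)
    using that ideal.I_l_closed[OF that(2,1)] by (auto simp: dualD(3) intro!: restrict_ext)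
qed

lemma bidual_map_inj: "inj_on (bidual_map R (ideal_module R I)) I"
proof (rule inj_onI)
  fix x y assume xy: "x \<in> I" "y \<in> I"
    "bidual_map R (ideal_module R I) x = bidual_map R (ideal_module R I) y"
  then have "(\<lambda>f\<in>dual. f x) = (\<lambda>f\<in>dual. f y)" by (simp add: bidual_map_eq)
  then have "(\<lambda>f\<in>dual. f x) (\<lambda>x\<in>I. x) = (\<lambda>f\<in>dual. f y) (\<lambda>x\<in>I. x)" by simp
  then show "x = y" using inclusion_dual xy by simp
qed

text \<open>The natural map is always linear, and evaluation at the inclusion shows that it is injective;
  only surjectivity is in question.\<close>

lemma reflexive_iff:
  "reflexive_module R (ideal_module R I) \<longleftrightarrow> (\<forall>\<Phi>\<in>bidual. \<exists>c\<in>I. \<forall>f\<in>dual. \<Phi> f = f c)"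
proof -
  have "reflexive_module R (ideal_module R I) \<longleftrightarrow> bidual_map R (ideal_module R I) ` I = bidual"
    using bidual_map_hom bidual_map_inj
    by (simp add: reflexive_module_def module_iso_def bij_betw_def ideal_module_simps)
  also have "bidual_map R (ideal_module R I) ` I = (\<lambda>c. \<lambda>f\<in>dual. f c) ` I"
    by (simp add: bidual_map_eq)
  also have "\<dots> = bidual \<longleftrightarrow> bidual \<subseteq> (\<lambda>c. \<lambda>f\<in>dual. f c) ` I"
    using evaluation_bidual by blast
  also have "\<dots> \<longleftrightarrow> (\<forall>\<Phi>\<in>bidual. \<exists>c\<in>I. \<forall>f\<in>dual. \<Phi> f = f c)"
  proof -
    have "\<Phi> = (\<lambda>f\<in>dual. f c) \<longleftrightarrow> (\<forall>f\<in>dual. \<Phi> f = f c)" if "\<Phi> \<in> bidual" for \<Phi> c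
    proof -
      have "\<Phi> \<in> extensional dual" using that unfolding bidual_iff by (simp add: PiE_def)
      then show ?thesis by (auto intro!: extensionalityI[of \<Phi> dual])
    qed
    then show ?thesis by (auto simp: subset_iff image_iff)
  qed
  finally show ?thesis .
qed

end

text \<open>Multiplication by \<open>y / x\<close> is a functional \<open>g\<close> on \<open>P\<close>. A functional \<open>\<Phi>\<close> on the dual is
  multiplication by \<open>c = \<Phi> (inclusion)\<close>, and \<open>\<Phi> g \<in> R\<close> says that \<open>c\<close> is a denominator
  of \<open>y / x\<close>, that is \<open>c \<in> P\<close>.\<close>

lemma (in cring) denominator_ideal_reflexive:
  assumes P: "primeideal P R" and fp: "denominator_ideal R P"
  shows "reflexive_module R (ideal_module R P)"
proof -
  interpret P: primeideal P R by fact
  interpret ideal_dual P R by unfold_locales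
  obtain x y where x: "x \<in> nonzerodivisors R" and y: "y \<in> carrier R"
    and "P = {r \<in> carrier R. \<exists>z \<in> carrier R. r \<otimes> y = x \<otimes> z}"
    using fp unfolding denominator_ideal_def by blast
  then have P_iff: "r \<in> P \<longleftrightarrow> r \<in> carrier R \<and> (\<exists>z \<in> carrier R. r \<otimes> y = x \<otimes> z)" for r by blast
  have xR: "x \<in> carrier R" using x by (simp add: nonzerodivisors_def)
  have xP: "x \<in> P" using P_iff xR y by blast
  have "\<forall>p\<in>P. \<exists>z. z \<in> carrier R \<and> p \<otimes> y = x \<otimes> z" using P_iff by blast
  then obtain g where g: "\<And>p. p \<in> P \<Longrightarrow> g p \<in> carrier R" "\<And>p. p \<in> P \<Longrightarrow> p \<otimes> y = x \<otimes> g p"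
    by metis
  have gD: "(\<lambda>p\<in>P. g p) \<in> dual"
  proof (rule dualI)
    fix p assume p: "p \<in> P"
    then show "g p \<in> carrier R" by (rule g(1))
    have pR: "p \<in> carrier R" using p by (rule P.Icarr)
    { fix q assume q: "q \<in> P"
      have qR: "q \<in> carrier R" using q by (rule P.Icarr)
      have pq: "p \<oplus> q \<in> P" by (rule ideal_add[OF P.is_ideal p q])
      have "x \<otimes> g (p \<oplus> q) = p \<otimes> y \<oplus> q \<otimes> y" using g(2)[OF pq] pR qR y by (simp add: l_distr)
      also have "\<dots> = x \<otimes> (g p \<oplus> g q)" using g p q xR by (simp add: r_distr)
      finally have eq: "x \<otimes> g (p \<oplus> q) = x \<otimes> (g p \<oplus> g q)" .
      show "g (p \<oplus> q) = g p \<oplus> g q"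
        by (rule nonzerodivisors_cancel[OF x _ _ eq]) (use g(1) p q pq in simp_all)
    }
    { fix r assume r: "r \<in> carrier R"
      have rp: "r \<otimes> p \<in> P" by (rule P.I_l_closed[OF p r])
      have "x \<otimes> g (r \<otimes> p) = r \<otimes> (p \<otimes> y)" using g(2)[OF rp] pR r y by (simp add: m_assoc)
      also have "\<dots> = x \<otimes> (r \<otimes> g p)" unfolding g(2)[OF p] using g(1)[OF p] r xR by (simp add: m_lcomm)
      finally have eq: "x \<otimes> g (r \<otimes> p) = x \<otimes> (r \<otimes> g p)" .
      show "g (r \<otimes> p) = r \<otimes> g p"
        by (rule nonzerodivisors_cancel[OF x _ _ eq]) (use g(1) p r rp in simp_all)
    }
  qed
  have "\<exists>c\<in>P. \<forall>f\<in>dual. \<Phi> f = f c" if \<Phi>: "\<Phi> \<in> bidual" for \<Phi>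
  proof -
    define c where "c = \<Phi> (\<lambda>p\<in>P. p)"
    have \<Phi>R: "\<Phi> f \<in> carrier R" if "f \<in> dual" for f using \<Phi> that unfolding bidual_iff by auto
    have cR: "c \<in> carrier R" unfolding c_def by (rule \<Phi>R[OF inclusion_dual])
    have key: "x \<otimes> \<Phi> f = f x \<otimes> c" if f: "f \<in> dual" for f
    proof -
      have fx: "f x \<in> carrier R" by (rule dualD(1)[OF f xP])
      have "(\<lambda>p\<in>P. x \<otimes> f p) = (\<lambda>p\<in>P. f x \<otimes> (\<lambda>p\<in>P. p) p)"
      proof (rule restrict_ext)
        fix p assume p: "p \<in> P"
        show "x \<otimes> f p = f x \<otimes> (\<lambda>p\<in>P. p) p"
          using dual_swap[OF f xP p] p fx P.Icarr[OF p] by (simp add: m_comm)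
      qed
      moreover have "\<Phi> (\<lambda>p\<in>P. x \<otimes> f p) = x \<otimes> \<Phi> f"
        using \<Phi> xR f unfolding bidual_iff by blast
      moreover have "\<Phi> (\<lambda>p\<in>P. f x \<otimes> (\<lambda>p\<in>P. p) p) = f x \<otimes> c"
        using \<Phi> fx inclusion_dual unfolding bidual_iff c_def by blast
      ultimately show ?thesis by simp
    qed
    have "c \<in> P"
    proof -
      have gx: "g x = y"
        by (rule nonzerodivisors_cancel[OF x g(1)[OF xP] y]) (use g(2)[OF xP] in simp)
      have "x \<otimes> \<Phi> (\<lambda>p\<in>P. g p) = g x \<otimes> c" using key[OF gD] xP by simp
      then have "c \<otimes> y = x \<otimes> \<Phi> (\<lambda>p\<in>P. g p)" using gx cR y by (simp add: m_comm)
      then show ?thesis unfolding P_iff using cR \<Phi>R[OF gD] by blast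
    qed
    moreover have "\<Phi> f = f c" if f: "f \<in> dual" for f
    proof -
      have eq: "x \<otimes> \<Phi> f = x \<otimes> f c"
        using key[OF f] dual_swap[OF f xP \<open>c \<in> P\<close>] cR dualD(1)[OF f xP] by (simp add: m_comm)
      show ?thesis
        by (rule nonzerodivisors_cancel[OF x \<Phi>R[OF f] dualD(1)[OF f \<open>c \<in> P\<close>] eq])
    qed
    ultimately show ?thesis by blast
  qed
  then show ?thesis unfolding reflexive_iff by blast
qed

text \<open>The numerators over \<open>a\<close> of the functionals on \<open>P\<close> form the ideal \<open>J = (aR : P)\<close>. If \<open>P\<close> were
  not a denominator ideal, each fraction \<open>y / a\<close> with \<open>y \<in> J\<close> would have a denominator outside
  \<open>P\<close>, and so would all of them simultaneously. Multiplication by such a common denominator \<open>d\<close>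
  is a functional on the dual that does not come from an element of \<open>P\<close>.\<close>

lemma (in noetherian_cring) reflexive_denominator_ideal:
  assumes P: "primeideal P R" and a: "a \<in> P" "a \<in> nonzerodivisors R"
    and refl: "reflexive_module R (ideal_module R P)"
  shows "denominator_ideal R P"
proof (rule ccontr)
  assume no: "\<not> ?thesis"
  interpret P: primeideal P R by fact
  interpret ideal_dual P R by unfold_locales
  have aR: "a \<in> carrier R" using a by auto
  define K where "K = Idl {a}"
  have K: "ideal K R" unfolding K_def by (rule genideal_ideal) (use aR in simp)
  have K_iff: "v \<in> K \<longleftrightarrow> (\<exists>z\<in>carrier R. v = a \<otimes> z)" for v
    unfolding K_def by (rule genideal_singleton[OF aR])
  define J where "J = {y \<in> carrier R. \<forall>p\<in>P. p \<otimes> y \<in> K}"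
  have J: "ideal J R"
  proof (rule idealI_cring)
    show "J \<subseteq> carrier R" by (auto simp: J_def)
    show "\<zero> \<in> J" using ideal_zero[OF K] P.Icarr by (simp add: J_def)
    fix u assume u: "u \<in> J"
    then have uR: "u \<in> carrier R" and uK: "\<And>p. p \<in> P \<Longrightarrow> p \<otimes> u \<in> K" by (auto simp: J_def)
    { fix v assume "v \<in> J"
      then have vR: "v \<in> carrier R" and vK: "\<And>p. p \<in> P \<Longrightarrow> p \<otimes> v \<in> K" by (auto simp: J_def)
      show "u \<oplus> v \<in> J"
        using ideal_add[OF K uK vK] P.Icarr uR vR by (simp add: J_def r_distr)
    }
    { fix r assume r: "r \<in> carrier R"
      show "r \<otimes> u \<in> J"
        using ideal.I_l_closed[OF K uK r] P.Icarr uR r by (simp add: J_def m_lcomm)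
    }
  qed
  have "\<exists>d\<in>carrier R - P. \<forall>y\<in>J. d \<otimes> y \<in> K"
  proof (rule uniform_multiplier[OF J K])
    show "\<one> \<in> carrier R - P" using P.I_notcarr P.one_imp_carrier by auto
    show "s \<otimes> t \<in> carrier R - P" if "s \<in> carrier R - P" "t \<in> carrier R - P" for s t
      using that P.I_prime[of s t] by auto
    fix y assume y: "y \<in> J"
    show "\<exists>d\<in>carrier R - P. d \<otimes> y \<in> K"
    proof (rule ccontr)
      assume "\<not> ?thesis"
      then have "P = {r \<in> carrier R. \<exists>z \<in> carrier R. r \<otimes> y = a \<otimes> z}"
        using y P.Icarr unfolding J_def K_iff by blast
      then show False using no a(2) y unfolding denominator_ideal_def J_def by blast
    qed
  qed auto
  then obtain d where d: "d \<in> carrier R" "d \<notin> P" "\<And>y. y \<in> J \<Longrightarrow> d \<otimes> y \<in> K" by blast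
  have "\<exists>z. z \<in> carrier R \<and> d \<otimes> f a = a \<otimes> z" if f: "f \<in> dual" for f
  proof -
    have "p \<otimes> f a \<in> K" if p: "p \<in> P" for p
      unfolding K_iff using dual_swap[OF f p a(1)] dualD(1)[OF f p] by blast
    then have "f a \<in> J" using dualD(1)[OF f a(1)] by (simp add: J_def)
    then show ?thesis using d(3) unfolding K_iff by blast
  qed
  then obtain F where F: "\<And>f. f \<in> dual \<Longrightarrow> F f \<in> carrier R" "\<And>f. f \<in> dual \<Longrightarrow> d \<otimes> f a = a \<otimes> F f"
    by metis
  have "(\<lambda>f\<in>dual. F f) \<in> bidual"
    unfolding bidual_iff
  proof (intro conjI ballI)
    show "(\<lambda>f\<in>dual. F f) \<in> dual \<rightarrow>\<^sub>E carrier R" using F(1) by simp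
    fix f assume f: "f \<in> dual"
    have fa: "f a \<in> carrier R" by (rule dualD(1)[OF f a(1)])
    { fix g assume g: "g \<in> dual"
      have ga: "g a \<in> carrier R" by (rule dualD(1)[OF g a(1)])
      let ?h = "\<lambda>x\<in>P. f x \<oplus> g x"
      have h: "?h \<in> dual" by (rule dual_add_closed[OF f g])
      have "a \<otimes> F ?h = d \<otimes> (f a \<oplus> g a)" using F(2)[OF h] a(1) by simp
      also have "\<dots> = a \<otimes> (F f \<oplus> F g)" using F[OF f] F[OF g] fa ga d(1) aR by (simp add: r_distr)
      finally have eq: "a \<otimes> F ?h = a \<otimes> (F f \<oplus> F g)" .
      have "F ?h = F f \<oplus> F g"
        by (rule nonzerodivisors_cancel[OF a(2) _ _ eq]) (use F(1) f g h in simp_all)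
      then show "(\<lambda>f\<in>dual. F f) ?h = (\<lambda>f\<in>dual. F f) f \<oplus> (\<lambda>f\<in>dual. F f) g"
        using f g h by simp
    }
  next
    fix r f assume r: "r \<in> carrier R" and f: "f \<in> dual"
    have fa: "f a \<in> carrier R" by (rule dualD(1)[OF f a(1)])
    let ?h = "\<lambda>x\<in>P. r \<otimes> f x"
    have h: "?h \<in> dual" by (rule dual_smult_closed[OF f r])
    have "a \<otimes> F ?h = r \<otimes> (d \<otimes> f a)" using F(2)[OF h] a(1) fa r d(1) by (simp add: m_lcomm)
    also have "\<dots> = a \<otimes> (r \<otimes> F f)" unfolding F(2)[OF f] using F(1)[OF f] r aR by (simp add: m_lcomm)
    finally have eq: "a \<otimes> F ?h = a \<otimes> (r \<otimes> F f)" .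
    have "F ?h = r \<otimes> F f"
      by (rule nonzerodivisors_cancel[OF a(2) _ _ eq]) (use F(1) f r h in simp_all)
    then show "(\<lambda>f\<in>dual. F f) ?h = r \<otimes> (\<lambda>f\<in>dual. F f) f" using f h by simp
  qed
  then obtain c where c: "c \<in> P" "\<And>f. f \<in> dual \<Longrightarrow> (\<lambda>f\<in>dual. F f) f = f c"
    using refl unfolding reflexive_iff by blast
  have "F (\<lambda>p\<in>P. p) = c" using c(2)[OF inclusion_dual] inclusion_dual c(1) by simp
  then have eq: "a \<otimes> d = a \<otimes> c" using F(2)[OF inclusion_dual] a(1) aR d(1) by (simp add: m_comm)
  have "d = c" by (rule nonzerodivisors_cancel[OF a(2) d(1) _ eq]) (use c(1) P.Icarr in simp)
  then show False using c d by simp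
qed

section \<open>Primes associated to the normalization\<close>

locale total_quotient = cring R for R (structure)

sublocale total_quotient \<subseteq> mult_submonoid R "nonzerodivisors R"
  by unfold_locales (auto simp: nonzerodivisors_closed, simp add: nonzerodivisors_def)

context total_quotient
begin

abbreviation "N \<equiv> tqr_image R"

lemma Q_eq: "total_quotient_ring R = L" by (simp add: total_quotient_ring_def)

lemma to_tqr_closed: "r \<in> carrier R \<Longrightarrow> to_tqr R r \<in> carrier L"
  unfolding to_tqr_def using frac_closed S_one by blast

lemma to_tqr_add:
  "\<lbrakk>r \<in> carrier R; s \<in> carrier R\<rbrakk> \<Longrightarrow> to_tqr R (r \<oplus> s) = to_tqr R r \<oplus>\<^bsub>L\<^esub> to_tqr R s"
  unfolding to_tqr_def using L_add[of r \<one> s \<one>] S_one by simp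

lemma to_tqr_mult:
  "\<lbrakk>r \<in> carrier R; s \<in> carrier R\<rbrakk> \<Longrightarrow> to_tqr R (r \<otimes> s) = to_tqr R r \<otimes>\<^bsub>L\<^esub> to_tqr R s"
  unfolding to_tqr_def using L_mult[of r \<one> s \<one>] S_one by simp

lemma to_tqr_one: "to_tqr R \<one> = \<one>\<^bsub>L\<^esub>" and to_tqr_zero: "to_tqr R \<zero> = \<zero>\<^bsub>L\<^esub>"
  by (simp_all add: to_tqr_def L_one L_zero)

lemma fraction_multiple_in_image_iff:
  assumes "r \<in> carrier R" "y \<in> carrier R" "x \<in> nonzerodivisors R"
  shows "to_tqr R r \<otimes>\<^bsub>L\<^esub> frac R (nonzerodivisors R) y x \<in> N \<longleftrightarrow> (\<exists>z\<in>carrier R. r \<otimes> y = x \<otimes> z)"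
proof -
  have xR: "x \<in> carrier R" using assms(3) by (rule S_in)
  have eq: "to_tqr R r \<otimes>\<^bsub>L\<^esub> frac R (nonzerodivisors R) y x = frac R (nonzerodivisors R) (r \<otimes> y) x"
    unfolding to_tqr_def using L_mult[OF assms(1) S_one assms(2,3)] xR by simp
  have "frac R (nonzerodivisors R) (r \<otimes> y) x = to_tqr R z \<longleftrightarrow> r \<otimes> y = x \<otimes> z" if z: "z \<in> carrier R" for z
  proof
    assume "r \<otimes> y = x \<otimes> z"
    then show "frac R (nonzerodivisors R) (r \<otimes> y) x = to_tqr R z"
      unfolding to_tqr_def by (intro frac_eqI) (use assms xR z S_one in simp_all)
  next
    assume "frac R (nonzerodivisors R) (r \<otimes> y) x = to_tqr R z"
    then obtain u where u: "u \<in> nonzerodivisors R" "u \<otimes> (\<one> \<otimes> (r \<otimes> y) \<ominus> x \<otimes> z) = \<zero>"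
      unfolding to_tqr_def using frac_eq_iff[of "r \<otimes> y" x z \<one>] assms z S_one by auto
    moreover have "\<one> \<otimes> (r \<otimes> y) \<ominus> x \<otimes> z \<in> carrier R" using assms xR z by simp
    ultimately have "\<one> \<otimes> (r \<otimes> y) \<ominus> x \<otimes> z = \<zero>" unfolding nonzerodivisors_def by blast
    then show "r \<otimes> y = x \<otimes> z" using assms xR z by simp
  qed
  then show ?thesis unfolding eq tqr_image_def image_iff by blast
qed

lemma coset_eq: "N +>\<^bsub>normalization R\<^esub> u = {n \<oplus>\<^bsub>L\<^esub> u | n. n \<in> N}"
  by (auto simp: a_r_coset_def' normalization_def Let_def Q_eq)

lemma N_closed: "N \<subseteq> carrier L" unfolding tqr_image_def using to_tqr_closed by blast

lemma to_tqr_in_N: "r \<in> carrier R \<Longrightarrow> to_tqr R r \<in> N"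
  unfolding tqr_image_def by (rule imageI)

lemma N_cases:
  assumes "n \<in> N"
  obtains r where "r \<in> carrier R" "n = to_tqr R r"
  using assms unfolding tqr_image_def by (rule imageE)

lemma N_add: "\<lbrakk>m \<in> N; n \<in> N\<rbrakk> \<Longrightarrow> m \<oplus>\<^bsub>L\<^esub> n \<in> N"
  by (elim N_cases) (simp add: to_tqr_add[symmetric] to_tqr_in_N)

lemma N_mult: "\<lbrakk>r \<in> carrier R; n \<in> N\<rbrakk> \<Longrightarrow> to_tqr R r \<otimes>\<^bsub>L\<^esub> n \<in> N"
  by (elim N_cases) (simp add: to_tqr_mult[symmetric] to_tqr_in_N)

lemma N_zero: "\<zero>\<^bsub>L\<^esub> \<in> N" using to_tqr_in_N[OF zero_closed] unfolding to_tqr_zero .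

lemma N_one: "\<one>\<^bsub>L\<^esub> \<in> N" using to_tqr_in_N[OF one_closed] unfolding to_tqr_one .

lemma N_neg: assumes "n \<in> N" shows "\<ominus>\<^bsub>L\<^esub> n \<in> N"
proof -
  obtain r where r: "r \<in> carrier R" "n = to_tqr R r" using assms by (rule N_cases)
  have "to_tqr R (\<ominus> r) \<oplus>\<^bsub>L\<^esub> n = \<zero>\<^bsub>L\<^esub>"
    unfolding r(2) using to_tqr_add[of "\<ominus> r" r] r(1) to_tqr_zero by (simp add: l_neg)
  then have "\<ominus>\<^bsub>L\<^esub> n = to_tqr R (\<ominus> r)"
    using r to_tqr_closed by (intro L.minus_equality) simp_all
  then show ?thesis using r(1) by (simp add: to_tqr_in_N)
qed

lemma coset_of_member:
  assumes "u \<in> N"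
  shows "N +>\<^bsub>normalization R\<^esub> u = N"
proof
  show "N +>\<^bsub>normalization R\<^esub> u \<subseteq> N" unfolding coset_eq using N_add assms by blast
  show "N \<subseteq> N +>\<^bsub>normalization R\<^esub> u"
  proof
    fix n assume n: "n \<in> N"
    have c: "n \<in> carrier L" "u \<in> carrier L" using n assms N_closed by auto
    have "n = (n \<oplus>\<^bsub>L\<^esub> \<ominus>\<^bsub>L\<^esub> u) \<oplus>\<^bsub>L\<^esub> u" using c by (simp add: L.a_assoc L.l_neg)
    then show "n \<in> N +>\<^bsub>normalization R\<^esub> u"
      unfolding coset_eq using N_add[OF n N_neg[OF assms]] by blast
  qed
qed

lemma smult_coset_zero_iff:
  assumes r: "r \<in> carrier R" and q: "q \<in> carrier L"
  shows "r \<odot>\<^bsub>quotient_module (normalization R) N\<^esub> (N +>\<^bsub>normalization R\<^esub> q)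
      = \<zero>\<^bsub>quotient_module (normalization R) N\<^esub> \<longleftrightarrow> to_tqr R r \<otimes>\<^bsub>L\<^esub> q \<in> N"
proof -
  let ?r = "to_tqr R r"
  have rL: "?r \<in> carrier L" by (rule to_tqr_closed[OF r])
  let ?U = "\<Union>x \<in> N +>\<^bsub>normalization R\<^esub> q. N +>\<^bsub>normalization R\<^esub> (?r \<otimes>\<^bsub>L\<^esub> x)"
  have smult: "r \<odot>\<^bsub>quotient_module (normalization R) N\<^esub> (N +>\<^bsub>normalization R\<^esub> q) = ?U"
    by (simp add: quotient_module_def normalization_def Let_def Q_eq)
  have zero: "\<zero>\<^bsub>quotient_module (normalization R) N\<^esub> = N" by (simp add: quotient_module_def)
  have self: "u \<in> N +>\<^bsub>normalization R\<^esub> u" if "u \<in> carrier L" for u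
  proof -
    have "u = \<zero>\<^bsub>L\<^esub> \<oplus>\<^bsub>L\<^esub> u" using that by simp
    then show ?thesis unfolding coset_eq using N_zero by blast
  qed
  show ?thesis
    unfolding smult zero
  proof
    assume U: "?U = N"
    have "?r \<otimes>\<^bsub>L\<^esub> q \<in> ?U"
      using self[OF q] self[OF L.m_closed[OF rL q]] by blast
    then show "?r \<otimes>\<^bsub>L\<^esub> q \<in> N" using U by simp
  next
    assume rq: "?r \<otimes>\<^bsub>L\<^esub> q \<in> N"
    have "N +>\<^bsub>normalization R\<^esub> (?r \<otimes>\<^bsub>L\<^esub> x) = N" if x: "x \<in> N +>\<^bsub>normalization R\<^esub> q" for x
    proof (rule coset_of_member)
      obtain n where n: "n \<in> N" "x = n \<oplus>\<^bsub>L\<^esub> q" using x unfolding coset_eq by blast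
      have "?r \<otimes>\<^bsub>L\<^esub> x = ?r \<otimes>\<^bsub>L\<^esub> n \<oplus>\<^bsub>L\<^esub> ?r \<otimes>\<^bsub>L\<^esub> q"
        unfolding n(2) by (rule L.r_distr) (use n(1) N_closed q rL in auto)
      then show "?r \<otimes>\<^bsub>L\<^esub> x \<in> N" using N_add[OF N_mult[OF r n(1)] rq] by simp
    qed
    then show "?U = N" by (rule UN_const[OF self[OF q]])
  qed
qed

lemma Ass_normalization_iff:
  "P \<in> Ass R (quotient_module (normalization R) N) \<longleftrightarrow>
    P \<in> Spec R \<and> (\<exists>q \<in> integral_closure L N. P = {r \<in> carrier R. to_tqr R r \<otimes>\<^bsub>L\<^esub> q \<in> N})"
proof -
  have carr: "carrier (quotient_module (normalization R) N) =
      (\<lambda>q. N +>\<^bsub>normalization R\<^esub> q) ` integral_closure L N"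
    by (auto simp: quotient_module_def A_RCOSETS_def' a_r_coset_def' normalization_def Let_def Q_eq)
  have "{r \<in> carrier R. r \<odot>\<^bsub>quotient_module (normalization R) N\<^esub> (N +>\<^bsub>normalization R\<^esub> q)
      = \<zero>\<^bsub>quotient_module (normalization R) N\<^esub>} = {r \<in> carrier R. to_tqr R r \<otimes>\<^bsub>L\<^esub> q \<in> N}"
    if "q \<in> integral_closure L N" for q
    using smult_coset_zero_iff[of _ q] that by (auto simp: integral_closure_def)
  then show ?thesis unfolding Ass_def carr by auto
qed

lemma Ass_normalization_denominator_ideal:
  assumes "P \<in> Ass R (quotient_module (normalization R) N)"
  shows "denominator_ideal R P"
proof -
  obtain q where q: "q \<in> carrier L" "P = {r \<in> carrier R. to_tqr R r \<otimes>\<^bsub>L\<^esub> q \<in> N}"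
    using assms unfolding Ass_normalization_iff integral_closure_def by blast
  obtain y x where yx: "y \<in> carrier R" "x \<in> nonzerodivisors R" "q = frac R (nonzerodivisors R) y x"
    using q(1) by (elim L_cases)
  have "P = {r \<in> carrier R. \<exists>z\<in>carrier R. r \<otimes> y = x \<otimes> z}"
    unfolding q(2) yx(3) using fraction_multiple_in_image_iff[OF _ yx(1,2)] by blast
  then show ?thesis unfolding denominator_ideal_def using yx(1,2) by blast
qed

end

text \<open>Let \<open>q = y / x\<close>. If \<open>q P \<subseteq> P\<close>, the sequence \<open>x, q x, q\<^sup>2 x, \<dots>\<close> stays in \<open>P\<close>, and a linear
  dependence in it, divided by \<open>x\<close>, is an equation of integral dependence for \<open>q\<close>. Otherwise
  \<open>q p = u\<close> for some \<open>p \<in> P\<close> and \<open>u \<notin> P\<close>; then \<open>P\<close> is generated by \<open>p\<close> in the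
  localization at \<open>P\<close>, because \<open>u a = (q a) p\<close>, and its height is at most one.\<close>

lemma (in noetherian_cring) denominator_ideal_Ass_normalization:
  assumes P: "primeideal P R" and ht: "enat 2 \<le> height R P" and fp: "denominator_ideal R P"
  shows "P \<in> Ass R (quotient_module (normalization R) (tqr_image R))"
proof -
  interpret total_quotient R by unfold_locales
  interpret P: primeideal P R by fact
  obtain x y where x: "x \<in> nonzerodivisors R" and y: "y \<in> carrier R"
    and P_eq: "P = {r \<in> carrier R. \<exists>z \<in> carrier R. r \<otimes> y = x \<otimes> z}"
    using fp unfolding denominator_ideal_def by blast
  have P_iff: "r \<in> P \<longleftrightarrow> r \<in> carrier R \<and> (\<exists>z \<in> carrier R. r \<otimes> y = x \<otimes> z)" for r
    using P_eq by blast
  have xR: "x \<in> carrier R" using x by (rule S_in)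
  have xP: "x \<in> P" using P_iff xR y by blast
  have stable: "\<exists>p'. p' \<in> P \<and> p \<otimes> y = x \<otimes> p'" if p: "p \<in> P" for p
  proof (rule ccontr)
    assume "\<not> ?thesis"
    then obtain u where u: "u \<in> carrier R" "u \<notin> P" "p \<otimes> y = x \<otimes> u" using p P_iff by blast
    have pR: "p \<in> carrier R" using p by (rule P.Icarr)
    have "\<exists>r\<in>carrier R. u \<otimes> a = p \<otimes> r" if a: "a \<in> P" for a
    proof -
      have aR: "a \<in> carrier R" using a by (rule P.Icarr)
      obtain z where z: "z \<in> carrier R" "a \<otimes> y = x \<otimes> z" using a P_iff by blast
      have "x \<otimes> (u \<otimes> a) = a \<otimes> (x \<otimes> u)" using xR u(1) aR by algebra
      also have "\<dots> = p \<otimes> (a \<otimes> y)" unfolding u(3)[symmetric] using aR pR y by algebra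
      also have "\<dots> = x \<otimes> (p \<otimes> z)" unfolding z(2) using pR xR z(1) by algebra
      finally have eq: "x \<otimes> (u \<otimes> a) = x \<otimes> (p \<otimes> z)" .
      have "u \<otimes> a = p \<otimes> z"
        by (rule nonzerodivisors_cancel[OF x _ _ eq]) (use u(1) aR pR z(1) in simp_all)
      then show ?thesis using z(1) by blast
    qed
    moreover obtain P0 P1 where "P0 \<in> Spec R" "P1 \<in> Spec R" "P0 \<subset> P1" "P1 \<subset> P"
      using height_2D[OF ht] by blast
    ultimately show False
      using locally_principal_prime_height[OF P _ _ _ _ p u(1,2), of P1 P0] unfolding Spec_def by blast
  qed
  define q where "q = frac R (nonzerodivisors R) y x"
  have qL: "q \<in> carrier L" unfolding q_def by (rule frac_closed[OF y x])
  obtain f where f: "\<And>p. p \<in> P \<Longrightarrow> f p \<in> P" "\<And>p. p \<in> P \<Longrightarrow> p \<otimes> y = x \<otimes> f p"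
    using stable by metis
  define w where "w = rec_nat x (\<lambda>_. f)"
  have w0: "w 0 = x" and wS: "\<And>n. w (Suc n) = f (w n)" by (simp_all add: w_def)
  have wP: "w n \<in> P" for n by (induction n) (simp_all add: w0 wS xP f(1))
  have wR: "w n \<in> carrier R" for n using wP by (rule P.Icarr)
  have to_w: "to_tqr R (w n) = q [^]\<^bsub>L\<^esub> n \<otimes>\<^bsub>L\<^esub> to_tqr R x" for n
  proof (induction n)
    case 0 then show ?case using to_tqr_closed[OF xR] by (simp add: w0)
  next
    case (Suc n)
    have "to_tqr R (w (Suc n)) = to_tqr R (w n) \<otimes>\<^bsub>L\<^esub> q"
    proof -
      have "to_tqr R (w n) \<otimes>\<^bsub>L\<^esub> q = frac R (nonzerodivisors R) (w n \<otimes> y) x"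
        unfolding to_tqr_def q_def using L_mult[OF wR S_one y x] xR by simp
      also have "\<dots> = to_tqr R (w (Suc n))" unfolding to_tqr_def
        by (rule frac_eqI) (use wR y x xR S_one f(2)[OF wP] wR[of "Suc n"] in \<open>simp_all add: wS\<close>)
      finally show ?thesis by simp
    qed
    then show ?case unfolding Suc using qL to_tqr_closed[OF xR] by (simp add: L.m_ac)
  qed
  \<comment> \<open>The coefficient list is negated so that prepending a leading one gives the polynomial
    that annihilates \<open>q\<close>.\<close>
  have comb: "\<exists>cs. length cs = n \<and> set cs \<subseteq> tqr_image R \<and>
      to_tqr R v \<oplus>\<^bsub>L\<^esub> ring.eval L cs q \<otimes>\<^bsub>L\<^esub> to_tqr R x = \<zero>\<^bsub>L\<^esub>" if "v \<in> prefix_ideal R w n" for v n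
    using that
  proof (induction n arbitrary: v)
    case 0
    then show ?case
      using to_tqr_closed[OF xR] by (intro exI[of _ "[]"]) (simp add: to_tqr_zero)
  next
    case (Suc n)
    then obtain v' r where v: "v = v' \<oplus> r \<otimes> w n" "v' \<in> prefix_ideal R w n" "r \<in> carrier R" by auto
    have v'R: "v' \<in> carrier R" using v(2) prefix_ideal_ideal[of w n] wR ideal_carrier by blast
    obtain cs where cs: "length cs = n" "set cs \<subseteq> tqr_image R"
      "to_tqr R v' \<oplus>\<^bsub>L\<^esub> ring.eval L cs q \<otimes>\<^bsub>L\<^esub> to_tqr R x = \<zero>\<^bsub>L\<^esub>" using Suc.IH[OF v(2)] by blast
    let ?r = "to_tqr R r" and ?x = "to_tqr R x" and ?v = "to_tqr R v'" and ?e = "ring.eval L cs q"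
      and ?p = "q [^]\<^bsub>L\<^esub> n"
    have c: "?r \<in> carrier L" "?x \<in> carrier L" "?v \<in> carrier L" "?e \<in> carrier L" "?p \<in> carrier L"
      using to_tqr_closed v(3) xR v'R L.eval_in_carrier[of cs q] cs(2) N_closed qL by auto
    have "to_tqr R v = ?v \<oplus>\<^bsub>L\<^esub> ?r \<otimes>\<^bsub>L\<^esub> (?p \<otimes>\<^bsub>L\<^esub> ?x)"
      unfolding v(1) using v(3) v'R wR by (simp add: to_tqr_add to_tqr_mult to_w)
    moreover have "ring.eval L ((\<ominus>\<^bsub>L\<^esub> ?r) # cs) q = (\<ominus>\<^bsub>L\<^esub> ?r) \<otimes>\<^bsub>L\<^esub> ?p \<oplus>\<^bsub>L\<^esub> ?e"
      by (simp add: cs(1))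
    moreover have "(?v \<oplus>\<^bsub>L\<^esub> ?r \<otimes>\<^bsub>L\<^esub> (?p \<otimes>\<^bsub>L\<^esub> ?x)) \<oplus>\<^bsub>L\<^esub> ((\<ominus>\<^bsub>L\<^esub> ?r) \<otimes>\<^bsub>L\<^esub> ?p \<oplus>\<^bsub>L\<^esub> ?e) \<otimes>\<^bsub>L\<^esub> ?x
        = ?v \<oplus>\<^bsub>L\<^esub> ?e \<otimes>\<^bsub>L\<^esub> ?x"
      using c by algebra
    ultimately have "to_tqr R v \<oplus>\<^bsub>L\<^esub> ring.eval L ((\<ominus>\<^bsub>L\<^esub> ?r) # cs) q \<otimes>\<^bsub>L\<^esub> ?x = \<zero>\<^bsub>L\<^esub>"
      using cs(3) by simp
    moreover have "\<ominus>\<^bsub>L\<^esub> ?r \<in> tqr_image R" using v(3) by (intro N_neg to_tqr_in_N)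
    ultimately show ?case using cs(1,2) by (intro exI[of _ "(\<ominus>\<^bsub>L\<^esub> ?r) # cs"]) simp
  qed
  obtain n where n: "w n \<in> prefix_ideal R w n" using sequence_dependent[of w] wR by blast
  obtain cs where cs: "length cs = n" "set cs \<subseteq> tqr_image R"
    "to_tqr R (w n) \<oplus>\<^bsub>L\<^esub> ring.eval L cs q \<otimes>\<^bsub>L\<^esub> to_tqr R x = \<zero>\<^bsub>L\<^esub>" using comb[OF n] by blast
  let ?e = "ring.eval L (\<one>\<^bsub>L\<^esub> # cs) q"
  have e: "?e = q [^]\<^bsub>L\<^esub> n \<oplus>\<^bsub>L\<^esub> ring.eval L cs q" using qL by (simp add: cs(1))
  have ecs: "ring.eval L cs q \<in> carrier L" using L.eval_in_carrier[of cs q] cs(2) N_closed qL by auto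
  have eL: "?e \<in> carrier L" unfolding e using ecs qL by simp
  have ex: "?e \<otimes>\<^bsub>L\<^esub> to_tqr R x = \<zero>\<^bsub>L\<^esub>"
    using cs(3) ecs qL to_tqr_closed[OF xR] unfolding e to_w by (simp add: L.l_distr)
  have inv: "to_tqr R x \<otimes>\<^bsub>L\<^esub> frac R (nonzerodivisors R) \<one> x = \<one>\<^bsub>L\<^esub>"
  proof -
    have "to_tqr R x \<otimes>\<^bsub>L\<^esub> frac R (nonzerodivisors R) \<one> x = frac R (nonzerodivisors R) x x"
      unfolding to_tqr_def using L_mult[OF xR S_one one_closed x] xR by simp
    also have "\<dots> = \<one>\<^bsub>L\<^esub>" unfolding L_one by (rule frac_eqI) (use x xR S_one in simp_all)
    finally show ?thesis .
  qed
  have iL: "frac R (nonzerodivisors R) \<one> x \<in> carrier L" by (rule frac_closed[OF one_closed x])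
  have "?e = ?e \<otimes>\<^bsub>L\<^esub> (to_tqr R x \<otimes>\<^bsub>L\<^esub> frac R (nonzerodivisors R) \<one> x)" using inv eL by simp
  also have "\<dots> = \<zero>\<^bsub>L\<^esub>"
    using ex L.m_assoc[OF eL to_tqr_closed[OF xR] iL] iL by simp
  finally have e0: "?e = \<zero>\<^bsub>L\<^esub>" .
  have "\<one>\<^bsub>L\<^esub> \<noteq> \<zero>\<^bsub>L\<^esub>"
  proof
    assume "\<one>\<^bsub>L\<^esub> = \<zero>\<^bsub>L\<^esub>"
    then obtain u where u: "u \<in> nonzerodivisors R" "u \<otimes> \<one> = \<zero>"
      unfolding L_one using frac_zero_iff[OF one_closed S_one] by auto
    then have "\<one> = \<zero>" unfolding nonzerodivisors_def by auto
    then show False using P.I_notcarr P.one_imp_carrier ideal_zero[OF P.is_ideal] by simp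
  qed
  then have "\<one>\<^bsub>L\<^esub> # cs \<in> carrier (univ_poly L (tqr_image R))"
    using cs(2) N_one by (simp add: univ_poly_def polynomial_def)
  then have "integral_over L (tqr_image R) q"
    unfolding integral_over_def using e0 by (intro bexI[of _ "\<one>\<^bsub>L\<^esub> # cs"]) auto
  then have "q \<in> integral_closure L (tqr_image R)" using qL by (simp add: integral_closure_def)
  moreover have "P = {r \<in> carrier R. to_tqr R r \<otimes>\<^bsub>L\<^esub> q \<in> tqr_image R}"
    unfolding P_eq q_def using fraction_multiple_in_image_iff[OF _ y x] by blast
  ultimately show ?thesis unfolding Ass_normalization_iff using P unfolding Spec_def by blast
qed

section \<open>The equivalence\<close>

theorem mainTheorem1:
  fixes R :: "('a, 'b) ring_scheme"
  assumes "cring R" and "noetherian_ring R" and "reduced_ring R"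
  shows "(serre_condition 2 R \<longleftrightarrow>
            height_ge R (Ass R (quotient_module (normalization R) (tqr_image R))) 2 = {}) \<and>
         (height_ge R (Ass R (quotient_module (normalization R) (tqr_image R))) 2 = {} \<longleftrightarrow>
            height_ge R {P \<in> Spec R. reflexive_module R (ideal_module R P)} 2 = {})"
proof -
  interpret reduced_noetherian_cring R
    using assms
    by (simp add: reduced_noetherian_cring_def reduced_noetherian_cring_axioms_def
        noetherian_cring_def)
  interpret total_quotient R by unfold_locales
  let ?A = "Ass R (quotient_module (normalization R) (tqr_image R))"
  have nzd: "\<exists>x\<in>P. x \<in> nonzerodivisors R" if P: "P \<in> Spec R" and ht: "enat 1 \<le> height R P" for P
  proof -
    obtain P0 where "P0 \<in> Spec R" "P0 \<subset> P" using height_1D[OF ht] by blast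
    then show ?thesis
      using nonminimal_prime_contains_nonzerodivisor[of P P0] P unfolding Spec_def by blast
  qed
  have pointwise: "(enat 2 \<le> local_depth (localization_at R P) \<longleftrightarrow> \<not> denominator_ideal R P) \<and>
      (P \<in> ?A \<longleftrightarrow> denominator_ideal R P) \<and>
      (reflexive_module R (ideal_module R P) \<longleftrightarrow> denominator_ideal R P)"
    if P: "P \<in> Spec R" and ht: "enat 2 \<le> height R P" for P
  proof -
    have prime: "primeideal P R" using P by (simp add: Spec_def)
    have "enat 1 \<le> height R P" using ht by (rule order_trans[rotated]) simp
    then obtain x where x: "x \<in> P" "x \<in> nonzerodivisors R" using nzd[OF P] by blast
    interpret loc: localization_at_prime P R
      using prime is_cring by (simp add: localization_at_prime_def)
    have "enat 2 \<le> local_depth (localization_at R P) \<longleftrightarrow> \<not> denominator_ideal R P"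
      using loc.denominator_ideal_depth depth_ge_2[OF prime x] by blast
    moreover have "P \<in> ?A \<longleftrightarrow> denominator_ideal R P"
      using Ass_normalization_denominator_ideal denominator_ideal_Ass_normalization[OF prime ht] by blast
    moreover have "reflexive_module R (ideal_module R P) \<longleftrightarrow> denominator_ideal R P"
      using denominator_ideal_reflexive[OF prime] reflexive_denominator_ideal[OF prime x] by blast
    ultimately show ?thesis by blast
  qed
  have serre: "serre_condition 2 R \<longleftrightarrow>
      (\<forall>P\<in>Spec R. enat 2 \<le> height R P \<longrightarrow> enat 2 \<le> local_depth (localization_at R P))"
    (is "_ \<longleftrightarrow> ?depth2")
  proof
    assume s: "serre_condition 2 R"
    show ?depth2
    proof (intro ballI impI)
      fix P assume P: "P \<in> Spec R" "enat 2 \<le> height R P"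
      have "min (enat 2) (height R P) \<le> local_depth (localization_at R P)"
        using s P(1) unfolding serre_condition_def by blast
      then show "enat 2 \<le> local_depth (localization_at R P)"
        unfolding min_absorb1[OF P(2)] .
    qed
  next
    assume d: ?depth2
    show "serre_condition 2 R"
      unfolding serre_condition_def
    proof
      fix P assume P: "P \<in> Spec R"
      show "min (enat 2) (height R P) \<le> local_depth (localization_at R P)"
      proof (cases "enat 2 \<le> height R P")
        case True
        then have "enat 2 \<le> local_depth (localization_at R P)" using d P by blast
        then show ?thesis by (rule min.coboundedI1)
      next
        case False
        then obtain h where h: "height R P = enat h" by (cases "height R P") simp_all
        then have "h < 2" using False by simp
        then consider "h = 0" | "h = 1" by linarith
        then have "height R P \<le> local_depth (localization_at R P)"
        proof cases
          case 1 then show ?thesis using h by (simp add: zero_enat_def[symmetric])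
        next
          case 2
          interpret loc: localization_at_prime P R
            using P is_cring by (simp add: localization_at_prime_def Spec_def)
          show ?thesis using nzd[OF P] loc.depth_ge_1 unfolding h 2 by blast
        qed
        then show ?thesis by (rule min.coboundedI2)
      qed
    qed
  qed
  have "?A \<subseteq> Spec R" unfolding Ass_def by blast
  then show ?thesis unfolding serre height_ge_def using pointwise by blast
qed

end
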